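(* Let $n\ge 2$ and let $M^n$ be a Lagrangian submanifold of the complex Euclidean space $\mathbb{C}^n$, or, more generally, of any Kähler manifold $(\tilde M^n,\tilde g,\tilde J)$ of complex dimension $n$. Let $T$ be a unit tangent vector field on $M^n$ and let $c\colon M^n\to(0,\infty)$ be a function. Then $T$ is a tangential principal Casorati vector field of $M^n$ with corresponding tangential principal Casorati curvature $c^T=c$ if and only if $N=\tilde J T$ is a normal principal Casorati vector field of $M^n$ with corresponding normal principal Casorati curvature $c^\perp=c$. That is, $A^C T=c\,T$ if and only if $a(\tilde J T)=c\,\tilde J T$, so that in this case $c^\perp=c^T>0$.
   Context: Let $(\tilde M^n,\tilde g,\tilde J)$ be a Kähler manifold of complex dimension $n$ (real dimension $2n$): $\tilde J^2=-I$, $\tilde g(\tilde J V,\tilde J W)=\tilde g(V,W)$, and $\tilde\nabla\tilde J=0$ for the Levi-Civita connection $\tilde\nabla$ of $\tilde g$. The space $\mathbb{C}^n=(\mathbb{E}^{2n},\tilde J)$ with its standard structure is an example. A submanifold $M$ of $\tilde M^n$ is Lagrangian if its real dimension is $n$ and $\tilde J(T_pM)=T_p^\perp M$ for all $p\in M$. It carries the induced metric $g$. Second fundamental form and shape operators: $h(X,Y)$ is the normal component of $\tilde\nabla_XY$ for tangent vector fields $X,Y$. For a normal vector $\xi$, $A_\xi$ is the symmetric endomorphism of the tangent space with $g(A_\xi X,Y)=\tilde g(h(X,Y),\xi)$. Casorati operator (tangential): $A^C=\sum_{\alpha=1}^n A_{\xi_\alpha}^2\colon T_pM\to T_pM$ at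 each point $p\in M$, where $\xi_1,\dots,\xi_n$ is any orthonormal basis of $T_p^\perp M$. It does not depend on the choice of basis. A tangential principal Casorati vector field with tangential principal Casorati curvature $c^T$ is a unit tangent vector field $T$ with $A^CT=c^T\,T$. Trenčevski operator (normal): $a\colon T_p^\perp M\to T_p^\perp M$ is the symmetric linear operator $a(\zeta)=\sum_{\alpha=1}^n \operatorname{tr}(A_\zeta A_{\xi_\alpha})\,\xi_\alpha$, for any orthonormal basis $\xi_1,\dots,\xi_n$ of $T_p^\perp M$. It does not depend on the choice of basis. A (first) normal principal Casorati vector field with normal principal Casorati curvature $c^\perp>0$ is a unit normal vector field $N$ with $a(N)=c^\perp N$. *)

theory Defs
  imports "HOL-Analysis.Analysis"
begin

section \<open>Smooth maps between Euclidean spaces\<close>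

text \<open>Only used for open domains: all iterated directional derivatives up to order \<open>k\<close> exist
  and are continuous.\<close>

fun Ck_on :: "nat \<Rightarrow> 'a::euclidean_space set \<Rightarrow> ('a \<Rightarrow> 'b::euclidean_space) \<Rightarrow> bool" where
  "Ck_on 0 S f \<longleftrightarrow> continuous_on S f"
| "Ck_on (Suc k) S f \<longleftrightarrow>
     (\<forall>x\<in>S. f differentiable (at x)) \<and> (\<forall>v. Ck_on k S (\<lambda>x. frechet_derivative f (at x) v))"

definition smooth_on :: "'a::euclidean_space set \<Rightarrow> ('a \<Rightarrow> 'b::euclidean_space) \<Rightarrow> bool" where
  "smooth_on S f \<longleftrightarrow> (\<forall>k. Ck_on k S f)"


section \<open>Smooth manifolds\<close>

text \<open>A chart is a domain together with a coordinate map, whose values outside the domain are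
  irrelevant. The dimension of the manifold is that of the model space \<open>'v\<close>.\<close>

type_synonym ('p, 'v) chart = "'p set \<times> ('p \<Rightarrow> 'v)"

record ('p, 'v) manifold =
  man_top :: "'p topology"
  atlas :: "('p, 'v) chart set"

abbreviation points :: "('p, 'v) manifold \<Rightarrow> 'p set" where
  "points M \<equiv> topspace (man_top M)"

abbreviation dom :: "('p, 'v) chart \<Rightarrow> 'p set" where
  "dom \<equiv> fst"

abbreviation coord :: "('p, 'v) chart \<Rightarrow> 'p \<Rightarrow> 'v" where
  "coord \<equiv> snd"

definition param :: "('p, 'v) chart \<Rightarrow> 'v \<Rightarrow> 'p" where
  "param \<phi> = inv_into (dom \<phi>) (coord \<phi>)"

definition second_countable_top :: "'p topology \<Rightarrow> bool" where
  "second_countable_top X \<longleftrightarrow>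
     (\<exists>\<B>. countable \<B> \<and> (\<forall>B\<in>\<B>. openin X B) \<and>
        (\<forall>U x. openin X U \<and> x \<in> U \<longrightarrow> (\<exists>B\<in>\<B>. x \<in> B \<and> B \<subseteq> U)))"

definition smooth_manifold :: "('p, 'v::euclidean_space) manifold \<Rightarrow> bool" where
  "smooth_manifold M \<longleftrightarrow>
     Hausdorff_space (man_top M) \<and> second_countable_top (man_top M) \<and>
     points M = (\<Union>\<phi>\<in>atlas M. dom \<phi>) \<and>
     (\<forall>\<phi>\<in>atlas M. openin (man_top M) (dom \<phi>) \<and> open (coord \<phi> ` dom \<phi>) \<and>
        homeomorphic_map (subtopology (man_top M) (dom \<phi>))
          (top_of_set (coord \<phi> ` dom \<phi>)) (coord \<phi>)) \<and>
     (\<forall>\<phi>\<in>atlas M. \<forall>\<psi>\<in>atlas M.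
        smooth_on (coord \<phi> ` (dom \<phi> \<inter> dom \<psi>)) (coord \<psi> \<circ> param \<phi>))"


section \<open>Tangent vectors, vector fields and tangent maps\<close>

text \<open>The tangent space at \<open>p\<close> is identified with the model space \<open>'v\<close> through one chart
  \<open>chart_at M p\<close> around \<open>p\<close>, chosen once and for all. Hence a vector field is a function
  \<open>'p \<Rightarrow> 'v\<close> whose value at \<open>q\<close> is expressed in \<open>chart_at M q\<close>; since this chart need not depend
  continuously on \<open>q\<close>, fields may only be differentiated after passing to the components in one
  fixed chart, by \<open>comps\<close>.\<close>

definition chart_at :: "('p, 'v) manifold \<Rightarrow> 'p \<Rightarrow> ('p, 'v) chart" where
  "chart_at M p = (SOME \<phi>. \<phi> \<in> atlas M \<and> p \<in> dom \<phi>)"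

text \<open>The components in the chart \<open>\<phi>\<close> of \<open>v \<in> T\<^sub>qM\<close>.\<close>

definition comps ::
    "('p, 'v::euclidean_space) manifold \<Rightarrow> ('p, 'v) chart \<Rightarrow> 'p \<Rightarrow> 'v \<Rightarrow> 'v" where
  "comps M \<phi> q v =
     frechet_derivative (coord \<phi> \<circ> param (chart_at M q)) (at (coord (chart_at M q) q)) v"

text \<open>Conversely, the vector field on \<open>dom \<phi>\<close> with constant components \<open>v\<close> in the chart \<open>\<phi>\<close>;
  for basis vectors \<open>v\<close> these are the coordinate fields of \<open>\<phi>\<close>.\<close>

definition const_field ::
    "('p, 'v::euclidean_space) manifold \<Rightarrow> ('p, 'v) chart \<Rightarrow> 'v \<Rightarrow> 'p \<Rightarrow> 'v" where
  "const_field M \<phi> v q =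
     frechet_derivative (coord (chart_at M q) \<circ> param \<phi>) (at (coord \<phi> q)) v"

definition smooth_fun :: "('p, 'v::euclidean_space) manifold \<Rightarrow> 'p set \<Rightarrow> ('p \<Rightarrow> real) \<Rightarrow> bool" where
  "smooth_fun M U u \<longleftrightarrow> (\<forall>\<phi>\<in>atlas M. smooth_on (coord \<phi> ` (dom \<phi> \<inter> U)) (u \<circ> param \<phi>))"

definition smooth_field :: "('p, 'v::euclidean_space) manifold \<Rightarrow> 'p set \<Rightarrow> ('p \<Rightarrow> 'v) \<Rightarrow> bool" where
  "smooth_field M U X \<longleftrightarrow>
     (\<forall>\<phi>\<in>atlas M. smooth_on (coord \<phi> ` (dom \<phi> \<inter> U)) ((\<lambda>q. comps M \<phi> q (X q)) \<circ> param \<phi>))"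

definition smooth_fun_near ::
    "('p, 'v::euclidean_space) manifold \<Rightarrow> 'p \<Rightarrow> ('p \<Rightarrow> real) \<Rightarrow> bool" where
  "smooth_fun_near M p u \<longleftrightarrow> (\<exists>U. openin (man_top M) U \<and> p \<in> U \<and> smooth_fun M U u)"

definition smooth_field_near ::
    "('p, 'v::euclidean_space) manifold \<Rightarrow> 'p \<Rightarrow> ('p \<Rightarrow> 'v) \<Rightarrow> bool" where
  "smooth_field_near M p X \<longleftrightarrow> (\<exists>U. openin (man_top M) U \<and> p \<in> U \<and> smooth_field M U X)"

text \<open>The derivative \<open>v(u)\<close> of the function \<open>u\<close> in the direction \<open>v \<in> T\<^sub>pM\<close>.\<close>

definition dir_deriv ::
    "('p, 'v::euclidean_space) manifold \<Rightarrow> ('p \<Rightarrow> real) \<Rightarrow> 'p \<Rightarrow> 'v \<Rightarrow> real" where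
  "dir_deriv M u p v =
     frechet_derivative (u \<circ> param (chart_at M p)) (at (coord (chart_at M p) p)) v"

definition lie_bracket ::
    "('p, 'v::euclidean_space) manifold \<Rightarrow> ('p \<Rightarrow> 'v) \<Rightarrow> ('p \<Rightarrow> 'v) \<Rightarrow> 'p \<Rightarrow> 'v" where
  "lie_bracket M X Y p =
     (let \<phi> = chart_at M p; D = (\<lambda>Z. frechet_derivative ((\<lambda>q. comps M \<phi> q (Z q)) \<circ> param \<phi>) (at (coord \<phi> p)))
      in D Y (X p) - D X (Y p))"

definition smooth_map :: "('m, 'v::euclidean_space) manifold \<Rightarrow> ('a, 'e::euclidean_space) manifold
    \<Rightarrow> ('m \<Rightarrow> 'a) \<Rightarrow> bool" where
  "smooth_map M N f \<longleftrightarrow>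
     continuous_map (man_top M) (man_top N) f \<and>
     (\<forall>\<phi>\<in>atlas M. \<forall>\<psi>\<in>atlas N.
        smooth_on (coord \<phi> ` (dom \<phi> \<inter> f -` dom \<psi>)) (coord \<psi> \<circ> f \<circ> param \<phi>))"

definition tangent_map :: "('m, 'v::euclidean_space) manifold \<Rightarrow> ('a, 'e::euclidean_space) manifold
    \<Rightarrow> ('m \<Rightarrow> 'a) \<Rightarrow> 'm \<Rightarrow> 'v \<Rightarrow> 'e" where
  "tangent_map M N f p =
     frechet_derivative (coord (chart_at N (f p)) \<circ> f \<circ> param (chart_at M p))
       (at (coord (chart_at M p) p))"

text \<open>Smooth sections of \<open>f\<^sup>*TN\<close>, that is, fields \<open>V\<close> with \<open>V p \<in> T\<^sub>f\<^sub>(\<^sub>p\<^sub>)N\<close>.\<close>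

definition smooth_field_along ::
    "('m, 'v::euclidean_space) manifold \<Rightarrow> ('a, 'e::euclidean_space) manifold
      \<Rightarrow> ('m \<Rightarrow> 'a) \<Rightarrow> ('m \<Rightarrow> 'e) \<Rightarrow> bool" where
  "smooth_field_along M N f V \<longleftrightarrow>
     (\<forall>\<phi>\<in>atlas M. \<forall>\<psi>\<in>atlas N.
        smooth_on (coord \<phi> ` (dom \<phi> \<inter> f -` dom \<psi>)) ((\<lambda>q. comps N \<psi> (f q) (V q)) \<circ> param \<phi>))"


section \<open>Kaehler manifolds\<close>

definition riemannian_metric ::
    "('p, 'v::euclidean_space) manifold \<Rightarrow> ('p \<Rightarrow> 'v \<Rightarrow> 'v \<Rightarrow> real) \<Rightarrow> bool" where
  "riemannian_metric N g \<longleftrightarrow>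
     (\<forall>p\<in>points N. bilinear (g p) \<and> (\<forall>v w. g p v w = g p w v) \<and> (\<forall>v. v \<noteq> 0 \<longrightarrow> g p v v > 0)) \<and>
     (\<forall>U X Y. openin (man_top N) U \<and> smooth_field N U X \<and> smooth_field N U Y \<longrightarrow>
        smooth_fun N U (\<lambda>q. g q (X q) (Y q)))"

text \<open>A connection is an operator on local fields: \<open>nab p v W\<close> is the covariant derivative
  at \<open>p\<close> of a field \<open>W\<close> that is smooth near \<open>p\<close>, in the direction \<open>v \<in> T\<^sub>pN\<close>. The Leibniz rule
  also allows functions \<open>u\<close> that are smooth only near \<open>p\<close>, so \<open>nab p v W\<close> depends only on the
  germ of \<open>W\<close> at \<open>p\<close>.\<close>

definition affine_connection ::
    "('p, 'v::euclidean_space) manifold \<Rightarrow> ('p \<Rightarrow> 'v \<Rightarrow> ('p \<Rightarrow> 'v) \<Rightarrow> 'v) \<Rightarrow> bool" where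
  "affine_connection N nab \<longleftrightarrow>
     (\<forall>p\<in>points N. \<forall>W. smooth_field_near N p W \<longrightarrow> linear (\<lambda>v. nab p v W)) \<and>
     (\<forall>p\<in>points N. \<forall>v W Z. smooth_field_near N p W \<and> smooth_field_near N p Z \<longrightarrow>
        nab p v (\<lambda>q. W q + Z q) = nab p v W + nab p v Z) \<and>
     (\<forall>p\<in>points N. \<forall>v u W. smooth_fun_near N p u \<and> smooth_field_near N p W \<longrightarrow>
        nab p v (\<lambda>q. u q *\<^sub>R W q) = dir_deriv N u p v *\<^sub>R W p + u p *\<^sub>R nab p v W) \<and>
     (\<forall>U X W. openin (man_top N) U \<and> smooth_field N U X \<and> smooth_field N U W \<longrightarrow>
        smooth_field N U (\<lambda>q. nab q (X q) W))"

definition levi_civita :: "('p, 'v::euclidean_space) manifold \<Rightarrow> ('p \<Rightarrow> 'v \<Rightarrow> 'v \<Rightarrow> real)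
    \<Rightarrow> ('p \<Rightarrow> 'v \<Rightarrow> ('p \<Rightarrow> 'v) \<Rightarrow> 'v) \<Rightarrow> bool" where
  "levi_civita N g nab \<longleftrightarrow>
     affine_connection N nab \<and>
     (\<forall>p\<in>points N. \<forall>X Y. smooth_field_near N p X \<and> smooth_field_near N p Y \<longrightarrow>
        nab p (X p) Y - nab p (Y p) X = lie_bracket N X Y p) \<and>
     (\<forall>p\<in>points N. \<forall>v Y Z. smooth_field_near N p Y \<and> smooth_field_near N p Z \<longrightarrow>
        dir_deriv N (\<lambda>q. g q (Y q) (Z q)) p v = g p (nab p v Y) (Z p) + g p (Y p) (nab p v Z))"

text \<open>The last condition is \<open>(\<nabla>\<^sub>vJ)W = \<nabla>\<^sub>v(JW) - J(\<nabla>\<^sub>vW) = 0\<close>.\<close>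

definition kaehler_manifold :: "('p, 'v::euclidean_space) manifold \<Rightarrow> ('p \<Rightarrow> 'v \<Rightarrow> 'v \<Rightarrow> real)
    \<Rightarrow> ('p \<Rightarrow> 'v \<Rightarrow> 'v) \<Rightarrow> ('p \<Rightarrow> 'v \<Rightarrow> ('p \<Rightarrow> 'v) \<Rightarrow> 'v) \<Rightarrow> bool" where
  "kaehler_manifold N g J nab \<longleftrightarrow>
     smooth_manifold N \<and> riemannian_metric N g \<and> levi_civita N g nab \<and>
     (\<forall>p\<in>points N. linear (J p)) \<and>
     (\<forall>U X. openin (man_top N) U \<and> smooth_field N U X \<longrightarrow> smooth_field N U (\<lambda>q. J q (X q))) \<and>
     (\<forall>p\<in>points N. \<forall>v. J p (J p v) = - v) \<and>
     (\<forall>p\<in>points N. \<forall>v w. g p (J p v) (J p w) = g p v w) \<and>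
     (\<forall>p\<in>points N. \<forall>v W. smooth_field_near N p W \<longrightarrow>
        nab p v (\<lambda>q. J q (W q)) = J p (nab p v W))"


section \<open>Lagrangian submanifolds and their second fundamental form\<close>

text \<open>Submanifolds are given by an immersion \<open>f\<close>; tangent vectors of the submanifold are elements
  of \<open>T\<^sub>pM\<close>, and \<open>tangent_space\<close> is their image in \<open>T\<^sub>f\<^sub>(\<^sub>p\<^sub>)N\<close>.\<close>

definition tangent_space :: "('m, 'v::euclidean_space) manifold
    \<Rightarrow> ('a, 'e::euclidean_space) manifold \<Rightarrow> ('m \<Rightarrow> 'a) \<Rightarrow> 'm \<Rightarrow> 'e set" where
  "tangent_space M N f p = range (tangent_map M N f p)"

definition normal_space :: "('m, 'v::euclidean_space) manifold
    \<Rightarrow> ('a, 'e::euclidean_space) manifold \<Rightarrow> ('a \<Rightarrow> 'e \<Rightarrow> 'e \<Rightarrow> real)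
    \<Rightarrow> ('m \<Rightarrow> 'a) \<Rightarrow> 'm \<Rightarrow> 'e set" where
  "normal_space M N g f p = {\<xi>. \<forall>w\<in>tangent_space M N f p. g (f p) \<xi> w = 0}"

definition lagrangian_submanifold :: "('m, 'v::euclidean_space) manifold
    \<Rightarrow> ('a, 'e::euclidean_space) manifold \<Rightarrow> ('a \<Rightarrow> 'e \<Rightarrow> 'e \<Rightarrow> real)
    \<Rightarrow> ('a \<Rightarrow> 'e \<Rightarrow> 'e) \<Rightarrow> ('m \<Rightarrow> 'a) \<Rightarrow> bool" where
  "lagrangian_submanifold M N g J f \<longleftrightarrow>
     smooth_manifold M \<and> smooth_map M N f \<and>
     (\<forall>p\<in>points M. inj (tangent_map M N f p)) \<and>
     2 * DIM('v) = DIM('e) \<and>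
     (\<forall>p\<in>points M. J (f p) ` tangent_space M N f p = normal_space M N g f p)"

definition induced_metric :: "('m, 'v::euclidean_space) manifold
    \<Rightarrow> ('a, 'e::euclidean_space) manifold \<Rightarrow> ('a \<Rightarrow> 'e \<Rightarrow> 'e \<Rightarrow> real)
    \<Rightarrow> ('m \<Rightarrow> 'a) \<Rightarrow> 'm \<Rightarrow> 'v \<Rightarrow> 'v \<Rightarrow> real" where
  "induced_metric M N g f p x y = g (f p) (tangent_map M N f p x) (tangent_map M N f p y)"

definition normal_component :: "('m, 'v::euclidean_space) manifold
    \<Rightarrow> ('a, 'e::euclidean_space) manifold \<Rightarrow> ('a \<Rightarrow> 'e \<Rightarrow> 'e \<Rightarrow> real)
    \<Rightarrow> ('m \<Rightarrow> 'a) \<Rightarrow> 'm \<Rightarrow> 'e \<Rightarrow> 'e" where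
  "normal_component M N g f p w =
     (THE \<xi>. \<xi> \<in> normal_space M N g f p \<and> w - \<xi> \<in> tangent_space M N f p)"

text \<open>The ambient covariant derivative \<open>\<nabla>\<^sub>xV\<close>, \<open>x \<in> T\<^sub>pM\<close>, of a field \<open>V\<close> along \<open>f\<close>. With the
  coordinate fields \<open>\<partial>\<^sub>k\<close> of the chart of \<open>N\<close> at \<open>f p\<close> and \<open>V = (\<Sum>k. V\<^sub>k \<partial>\<^sub>k)\<close> it is
  \<open>(\<Sum>k. x(V\<^sub>k) \<partial>\<^sub>k + V\<^sub>k(p) \<nabla>\<^bsub>df(x)\<^esub> \<partial>\<^sub>k)\<close>, and the second half is the covariant derivative of the
  constant-component field with value \<open>V p\<close>.\<close>

definition deriv_along :: "('m, 'v::euclidean_space) manifold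
    \<Rightarrow> ('a, 'e::euclidean_space) manifold \<Rightarrow> ('a \<Rightarrow> 'e \<Rightarrow> ('a \<Rightarrow> 'e) \<Rightarrow> 'e)
    \<Rightarrow> ('m \<Rightarrow> 'a) \<Rightarrow> 'm \<Rightarrow> 'v \<Rightarrow> ('m \<Rightarrow> 'e) \<Rightarrow> 'e" where
  "deriv_along M N nab f p x V =
     (let \<phi> = chart_at M p; \<psi> = chart_at N (f p) in
        frechet_derivative ((\<lambda>q. comps N \<psi> (f q) (V q)) \<circ> param \<phi>) (at (coord \<phi> p)) x
        + nab (f p) (tangent_map M N f p x) (const_field N \<psi> (V p)))"

text \<open>\<open>h(x,y)\<close> is the normal component of \<open>\<nabla>\<^sub>xY\<close> for any local tangent field \<open>Y\<close> of \<open>M\<close> that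
  extends \<open>y\<close>; the choice of \<open>Y\<close> does not matter.\<close>

definition second_ff :: "('m, 'v::euclidean_space) manifold
    \<Rightarrow> ('a, 'e::euclidean_space) manifold \<Rightarrow> ('a \<Rightarrow> 'e \<Rightarrow> 'e \<Rightarrow> real)
    \<Rightarrow> ('a \<Rightarrow> 'e \<Rightarrow> ('a \<Rightarrow> 'e) \<Rightarrow> 'e) \<Rightarrow> ('m \<Rightarrow> 'a) \<Rightarrow> 'm \<Rightarrow> 'v \<Rightarrow> 'v \<Rightarrow> 'e" where
  "second_ff M N g nab f p x y =
     (THE \<eta>. \<forall>Y. smooth_field_near M p Y \<and> Y p = y \<longrightarrow>
        normal_component M N g f p
          (deriv_along M N nab f p x (\<lambda>q. tangent_map M N f q (Y q))) = \<eta>)"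

definition shape_operator :: "('m, 'v::euclidean_space) manifold
    \<Rightarrow> ('a, 'e::euclidean_space) manifold \<Rightarrow> ('a \<Rightarrow> 'e \<Rightarrow> 'e \<Rightarrow> real)
    \<Rightarrow> ('a \<Rightarrow> 'e \<Rightarrow> ('a \<Rightarrow> 'e) \<Rightarrow> 'e) \<Rightarrow> ('m \<Rightarrow> 'a) \<Rightarrow> 'm \<Rightarrow> 'e \<Rightarrow> 'v \<Rightarrow> 'v" where
  "shape_operator M N g nab f p \<xi> x =
     (THE z. \<forall>y. induced_metric M N g f p z y = g (f p) (second_ff M N g nab f p x y) \<xi>)"


section \<open>The Casorati and Trencevski operators\<close>

definition normal_onb :: "('m, 'v::euclidean_space) manifold
    \<Rightarrow> ('a, 'e::euclidean_space) manifold \<Rightarrow> ('a \<Rightarrow> 'e \<Rightarrow> 'e \<Rightarrow> real)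
    \<Rightarrow> ('m \<Rightarrow> 'a) \<Rightarrow> 'm \<Rightarrow> 'e set \<Rightarrow> bool" where
  "normal_onb M N g f p B \<longleftrightarrow>
     finite B \<and> span B = normal_space M N g f p \<and>
     (\<forall>\<xi>\<in>B. \<forall>\<eta>\<in>B. g (f p) \<xi> \<eta> = (if \<xi> = \<eta> then 1 else 0))"

text \<open>Both operators are independent of the orthonormal basis of the normal space.\<close>

definition casorati_operator :: "('m, 'v::euclidean_space) manifold
    \<Rightarrow> ('a, 'e::euclidean_space) manifold \<Rightarrow> ('a \<Rightarrow> 'e \<Rightarrow> 'e \<Rightarrow> real)
    \<Rightarrow> ('a \<Rightarrow> 'e \<Rightarrow> ('a \<Rightarrow> 'e) \<Rightarrow> 'e) \<Rightarrow> ('m \<Rightarrow> 'a) \<Rightarrow> 'm \<Rightarrow> 'v \<Rightarrow> 'v" where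
  "casorati_operator M N g nab f p x =
     (\<Sum>\<xi>\<in>(SOME B. normal_onb M N g f p B).
        shape_operator M N g nab f p \<xi> (shape_operator M N g nab f p \<xi> x))"

definition trencevski_operator :: "('m, real^'n) manifold
    \<Rightarrow> ('a, 'e::euclidean_space) manifold \<Rightarrow> ('a \<Rightarrow> 'e \<Rightarrow> 'e \<Rightarrow> real)
    \<Rightarrow> ('a \<Rightarrow> 'e \<Rightarrow> ('a \<Rightarrow> 'e) \<Rightarrow> 'e) \<Rightarrow> ('m \<Rightarrow> 'a) \<Rightarrow> 'm \<Rightarrow> 'e \<Rightarrow> 'e" where
  "trencevski_operator M N g nab f p \<zeta> =
     (\<Sum>\<xi>\<in>(SOME B. normal_onb M N g f p B).
        trace (matrix (shape_operator M N g nab f p \<zeta> \<circ> shape_operator M N g nab f p \<xi>)) *\<^sub>R \<xi>)"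

definition unit_tangent_field :: "('m, 'v::euclidean_space) manifold
    \<Rightarrow> ('a, 'e::euclidean_space) manifold \<Rightarrow> ('a \<Rightarrow> 'e \<Rightarrow> 'e \<Rightarrow> real)
    \<Rightarrow> ('m \<Rightarrow> 'a) \<Rightarrow> ('m \<Rightarrow> 'v) \<Rightarrow> bool" where
  "unit_tangent_field M N g f T \<longleftrightarrow>
     smooth_field M (points M) T \<and> (\<forall>p\<in>points M. induced_metric M N g f p (T p) (T p) = 1)"

definition unit_normal_field :: "('m, 'v::euclidean_space) manifold
    \<Rightarrow> ('a, 'e::euclidean_space) manifold \<Rightarrow> ('a \<Rightarrow> 'e \<Rightarrow> 'e \<Rightarrow> real)
    \<Rightarrow> ('m \<Rightarrow> 'a) \<Rightarrow> ('m \<Rightarrow> 'e) \<Rightarrow> bool" where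
  "unit_normal_field M N g f V \<longleftrightarrow>
     smooth_field_along M N f V \<and>
     (\<forall>p\<in>points M. V p \<in> normal_space M N g f p \<and> g (f p) (V p) (V p) = 1)"

definition tangential_principal_casorati :: "('m, 'v::euclidean_space) manifold
    \<Rightarrow> ('a, 'e::euclidean_space) manifold \<Rightarrow> ('a \<Rightarrow> 'e \<Rightarrow> 'e \<Rightarrow> real)
    \<Rightarrow> ('a \<Rightarrow> 'e \<Rightarrow> ('a \<Rightarrow> 'e) \<Rightarrow> 'e) \<Rightarrow> ('m \<Rightarrow> 'a) \<Rightarrow> ('m \<Rightarrow> 'v) \<Rightarrow> ('m \<Rightarrow> real) \<Rightarrow> bool" where
  "tangential_principal_casorati M N g nab f T c \<longleftrightarrow>
     unit_tangent_field M N g f T \<and>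
     (\<forall>p\<in>points M. casorati_operator M N g nab f p (T p) = c p *\<^sub>R T p)"

definition normal_principal_casorati :: "('m, real^'n) manifold
    \<Rightarrow> ('a, 'e::euclidean_space) manifold \<Rightarrow> ('a \<Rightarrow> 'e \<Rightarrow> 'e \<Rightarrow> real)
    \<Rightarrow> ('a \<Rightarrow> 'e \<Rightarrow> ('a \<Rightarrow> 'e) \<Rightarrow> 'e) \<Rightarrow> ('m \<Rightarrow> 'a) \<Rightarrow> ('m \<Rightarrow> 'e) \<Rightarrow> ('m \<Rightarrow> real) \<Rightarrow> bool" where
  "normal_principal_casorati M N g nab f V c \<longleftrightarrow>
     unit_normal_field M N g f V \<and>
     (\<forall>p\<in>points M. c p > 0 \<and> trencevski_operator M N g nab f p (V p) = c p *\<^sub>R V p)"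

end

(*
  For a Lagrangian immersion L = df into a Kaehler manifold the cubic form
  C(x,y,z) = g(h(x,y), J L z) is totally symmetric: the symmetry in x and y holds because the ambient
  connection is torsion-free; differentiating g(L Y, J L Z) = 0 and using that J is parallel and
  skew gives the symmetry in y and z. Hence the shape operators satisfy A_{J x} y = A_{J y} x. For an
  orthonormal basis e of the tangent space, A^C x = sum_e A_{J e} A_{J e} x, and the e-component of
  J^{-1} a(J x) is tr(A_{J x} A_{J e}) = sum_d g(A_{J e} d, A_{J x} d) = g(A^C x, e). So a(J x) = J(A^C x).
*)

theory Submission
  imports Defs
begin

section \<open>Calculus of smooth maps\<close>

text \<open>The obstacle is that \<open>nab\<close> differentiates only fields on open sets of
  \<open>N\<close>, while the fields df Y and J (df Z) live along \<open>f\<close>. No extension of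
  them to \<open>N\<close> is constructed. Instead the axioms of \<open>nab\<close> are evaluated on
  fields with constant components in the chart at \<open>f p\<close> and on their images under
  \<open>J\<close>. Metric compatibility and the parallelism of \<open>J\<close> then become
  formulas, in terms of Christoffel symbols, for the derivatives of the coefficients of
  \<open>g\<close> and \<open>J\<close> at one point. The chain rule through the coordinate
  expression \<open>F\<close> of \<open>f\<close> carries these formulas over to fields along
  \<open>f\<close>. In coordinates the symmetry of h splits into symmetry of the Christoffel
  symbols, which is torsion-freeness, and symmetry of the second derivatives of \<open>F\<close>.
  The latter is Schwarz's theorem for \<open>smooth_on\<close>, hence the calculus at the start. A
  second mismatch is metric: traces are taken in the coordinate basis of the model space, which is
  unrelated to the induced metric, so the trace must be rewritten in a basis orthonormal for that
  metric.\<close>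

lemma frechet_derivative_has_derivative:
  "f differentiable (at x) \<Longrightarrow> (f has_derivative frechet_derivative f (at x)) (at x)"
  using frechet_derivative_works by blast

lemma frechet_derivative_cong_open:
  assumes "open S" "x \<in> S" "\<And>y. y \<in> S \<Longrightarrow> f y = g y"
  shows "frechet_derivative f (at x) = frechet_derivative g (at x)"
proof -
  have "(f has_derivative D) (at x) \<longleftrightarrow> (g has_derivative D) (at x)" for D
    using has_derivative_transform_within_open[OF _ assms(1,2)] assms(3) by metis
  then show ?thesis by (simp add: frechet_derivative_def)
qed

lemma differentiable_cong_open:
  assumes "open S" "x \<in> S" "\<And>y. y \<in> S \<Longrightarrow> f y = g y" "f differentiable (at x)"
  shows "g differentiable (at x)"
  using has_derivative_transform_within_open[OF _ assms(1,2)] assms(3,4)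
  unfolding differentiable_def by metis

section \<open>Closure properties of iterated differentiability\<close>

lemma Ck_on_cong:
  assumes "open S" "\<And>x. x \<in> S \<Longrightarrow> f x = g x" "Ck_on k S f"
  shows "Ck_on k S g"
  using assms(2,3)
proof (induction k arbitrary: f g)
  case 0
  then show ?case using continuous_on_cong[of S S f g] by auto
next
  case (Suc k)
  have "Ck_on k S (\<lambda>x. frechet_derivative g (at x) v)" for v
    using Suc.IH[of "\<lambda>x. frechet_derivative f (at x) v"] Suc.prems
      frechet_derivative_cong_open[OF \<open>open S\<close>, of _ f g] by auto
  then show ?case
    using Suc.prems differentiable_cong_open[OF \<open>open S\<close>, of _ f g] by auto
qed

lemma Ck_on_subset: "Ck_on k S f \<Longrightarrow> T \<subseteq> S \<Longrightarrow> Ck_on k T f"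
  by (induction k arbitrary: f) (auto intro: continuous_on_subset)

text \<open>\<open>Ck_on (Suc k)\<close> asks for differentiability of \<open>f\<close> and for
  \<open>Ck_on k\<close> of its directional derivatives, so continuity of \<open>f\<close> itself
  has to be recovered from differentiability.\<close>

lemma Ck_on_Suc_imp: "Ck_on (Suc k) S f \<Longrightarrow> Ck_on k S f"
proof (induction k arbitrary: f)
  case 0
  then show ?case
    by (auto intro!: continuous_at_imp_continuous_on differentiable_imp_continuous_within)
next
  case (Suc k)
  then show ?case by simp
qed

lemma Ck_on_const: "Ck_on k S (\<lambda>x. c)"
proof (induction k arbitrary: c)
  case (Suc k)
  have "frechet_derivative (\<lambda>x::'a. c) (at x) = (\<lambda>v. 0)" for x
    by (simp add: frechet_derivative_at[OF has_derivative_const, symmetric])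
  then show ?case by (simp add: Suc)
qed auto

lemma Ck_on_add:
  assumes "open S" "Ck_on k S f" "Ck_on k S g"
  shows "Ck_on k S (\<lambda>x. f x + g x)"
  using assms(2,3)
proof (induction k arbitrary: f g)
  case 0
  then show ?case by (auto intro: continuous_intros)
next
  case (Suc k)
  have d: "((\<lambda>x. f x + g x) has_derivative
      (\<lambda>v. frechet_derivative f (at x) v + frechet_derivative g (at x) v)) (at x)" if "x \<in> S" for x
    using Suc.prems that by (intro has_derivative_add) (auto simp: frechet_derivative_has_derivative)
  have "Ck_on k S (\<lambda>x. frechet_derivative (\<lambda>x. f x + g x) (at x) v)" for v
    by (rule Ck_on_cong[OF \<open>open S\<close> _ Suc.IH[of "\<lambda>x. frechet_derivative f (at x) v" "\<lambda>x. frechet_derivative g (at x) v"]])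
      (use Suc.prems frechet_derivative_at[OF d] in \<open>auto dest: fun_cong\<close>)
  then show ?case using d by (auto simp: differentiable_def)
qed

lemma Ck_on_sum:
  assumes "open S" "\<And>i. i \<in> I \<Longrightarrow> Ck_on k S (f i)"
  shows "Ck_on k S (\<lambda>x. \<Sum>i\<in>I. f i x)"
  using assms(2) by (induction I rule: infinite_finite_induct) (auto intro: Ck_on_const Ck_on_add[OF assms(1)])

lemma Ck_on_scaleR:
  assumes "open S" "Ck_on k S u" "Ck_on k S f"
  shows "Ck_on k S (\<lambda>x. u x *\<^sub>R f x)"
  using assms(2,3)
proof (induction k arbitrary: u f)
  case 0
  then show ?case by (auto intro: continuous_intros)
next
  case (Suc k)
  have d: "((\<lambda>x. u x *\<^sub>R f x) has_derivative
      (\<lambda>v. u x *\<^sub>R frechet_derivative f (at x) v + frechet_derivative u (at x) v *\<^sub>R f x)) (at x)"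
    if "x \<in> S" for x
    using Suc.prems that by (intro has_derivative_scaleR) (auto simp: frechet_derivative_has_derivative)
  \<comment> \<open>The product rule leaves \<open>u\<close> and \<open>f\<close> undifferentiated;
    both are lowered by one order before the induction hypothesis applies.\<close>
  have "Ck_on k S (\<lambda>x. u x *\<^sub>R frechet_derivative f (at x) v + frechet_derivative u (at x) v *\<^sub>R f x)" for v
    using Suc.prems Ck_on_Suc_imp[of k S f] Ck_on_Suc_imp[of k S u]
    by (intro Ck_on_add[OF \<open>open S\<close>] Suc.IH) auto
  then have "Ck_on k S (\<lambda>x. frechet_derivative (\<lambda>x. u x *\<^sub>R f x) (at x) v)" for v
    by (rule Ck_on_cong[OF \<open>open S\<close>, rotated]) (use frechet_derivative_at[OF d] in \<open>auto dest: fun_cong\<close>)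
  then show ?case using d by (auto simp: differentiable_def)
qed

lemma Ck_on_bounded_linear_comp:
  assumes "open S" "bounded_linear l" "Ck_on k S f"
  shows "Ck_on k S (\<lambda>x. l (f x))"
  using assms(3)
proof (induction k arbitrary: f)
  case 0
  then show ?case using bounded_linear.continuous_on[OF assms(2)] by simp
next
  case (Suc k)
  have d: "((\<lambda>x. l (f x)) has_derivative (\<lambda>v. l (frechet_derivative f (at x) v))) (at x)"
    if "x \<in> S" for x
    using Suc.prems that by (intro bounded_linear.has_derivative[OF assms(2)]) (auto simp: frechet_derivative_has_derivative)
  have "Ck_on k S (\<lambda>x. frechet_derivative (\<lambda>x. l (f x)) (at x) v)" for v
    by (rule Ck_on_cong[OF \<open>open S\<close> _ Suc.IH[of "\<lambda>x. frechet_derivative f (at x) v"]])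
      (use Suc.prems frechet_derivative_at[OF d] in \<open>auto dest: fun_cong\<close>)
  then show ?case using d by (auto simp: differentiable_def)
qed

lemma linear_sum_Basis:
  fixes l :: "'a::euclidean_space \<Rightarrow> 'b::real_vector"
  assumes "linear l" shows "l v = (\<Sum>i\<in>Basis. (v \<bullet> i) *\<^sub>R l i)"
proof -
  have "l v = l (\<Sum>i\<in>Basis. (v \<bullet> i) *\<^sub>R i)" by (simp add: euclidean_representation)
  then show ?thesis by (simp only: linear_sum[OF assms] linear_scale[OF assms])
qed

lemma Ck_on_compose:
  assumes "open S" "open T" "f ` S \<subseteq> T" "Ck_on k S f" "Ck_on k T g"
  shows "Ck_on k S (\<lambda>x. g (f x))"
  using assms(4,5)
proof (induction k arbitrary: g)
  case 0
  then show ?case using assms(3) continuous_on_compose2[of T g S f] by auto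
next
  case (Suc k)
  have d: "((\<lambda>x. g (f x)) has_derivative
      (\<lambda>v. frechet_derivative g (at (f x)) (frechet_derivative f (at x) v))) (at x)"
    if "x \<in> S" for x
    using Suc.prems that assms(3)
    by (intro has_derivative_compose[of f _ _ _ g]) (auto simp: frechet_derivative_has_derivative image_subset_iff)
  \<comment> \<open>In the chain rule the derivative of \<open>g\<close> is applied to a vector that
    moves with \<open>x\<close>. Expanding that vector in the basis leaves derivatives of
    \<open>g\<close> in fixed directions, composed with \<open>f\<close>, to which the induction
    hypothesis (general in \<open>g\<close>) applies.\<close>
  have "Ck_on k S (\<lambda>x. \<Sum>i\<in>Basis. (frechet_derivative f (at x) v \<bullet> i) *\<^sub>R frechet_derivative g (at (f x)) i)" for v
  proof (intro Ck_on_sum Ck_on_scaleR \<open>open S\<close>)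
    fix i
    show "Ck_on k S (\<lambda>x. frechet_derivative f (at x) v \<bullet> i)"
      using Suc.prems by (intro Ck_on_bounded_linear_comp[OF \<open>open S\<close> bounded_linear_inner_left]) auto
    show "Ck_on k S (\<lambda>x. frechet_derivative g (at (f x)) i)"
      using Suc.prems Ck_on_Suc_imp[of k S f] by (intro Suc.IH) auto
  qed
  then have "Ck_on k S (\<lambda>x. frechet_derivative (\<lambda>x. g (f x)) (at x) v)" for v
  proof (rule Ck_on_cong[OF \<open>open S\<close>, rotated])
    fix x assume "x \<in> S"
    have "linear (frechet_derivative g (at (f x)))"
      using \<open>x \<in> S\<close> assms(3) Suc.prems by (intro linear_frechet_derivative) auto
    from linear_sum_Basis[OF this, of "frechet_derivative f (at x) v"]
    show "(\<Sum>i\<in>Basis. (frechet_derivative f (at x) v \<bullet> i) *\<^sub>R frechet_derivative g (at (f x)) i)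
      = frechet_derivative (\<lambda>x. g (f x)) (at x) v"
      using frechet_derivative_at[OF d[OF \<open>x \<in> S\<close>]] by metis
  qed
  then show ?case using d by (auto simp: differentiable_def)
qed

lemma smooth_on_cong: "open S \<Longrightarrow> smooth_on S f \<Longrightarrow> (\<And>x. x \<in> S \<Longrightarrow> f x = g x) \<Longrightarrow> smooth_on S g"
  using Ck_on_cong[of S f g] unfolding smooth_on_def by auto

lemma smooth_on_subset: "smooth_on S f \<Longrightarrow> T \<subseteq> S \<Longrightarrow> smooth_on T f"
  using Ck_on_subset unfolding smooth_on_def by blast

lemma smooth_on_differentiable: "smooth_on S f \<Longrightarrow> x \<in> S \<Longrightarrow> f differentiable (at x)"
  unfolding smooth_on_def by (metis Ck_on.simps(2))

lemma smooth_on_has_derivative: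
  "smooth_on S f \<Longrightarrow> x \<in> S \<Longrightarrow> (f has_derivative frechet_derivative f (at x)) (at x)"
  using smooth_on_differentiable frechet_derivative_has_derivative by blast

lemma smooth_on_frechet: "smooth_on S f \<Longrightarrow> smooth_on S (\<lambda>x. frechet_derivative f (at x) v)"
  unfolding smooth_on_def by (metis Ck_on.simps(2))

lemma smooth_on_const: "smooth_on S (\<lambda>x. c)"
  by (simp add: smooth_on_def Ck_on_const)

lemma smooth_on_compose:
  assumes "open S" "open T" "f ` S \<subseteq> T" "smooth_on S f" "smooth_on T g"
  shows "smooth_on S (\<lambda>x. g (f x))"
  using Ck_on_compose[OF assms(1-3)] assms(4,5) by (auto simp: smooth_on_def)

lemma smooth_on_sum_scaleR:
  assumes "open S" "\<And>i. i \<in> I \<Longrightarrow> smooth_on S (u i)" "\<And>i. i \<in> I \<Longrightarrow> smooth_on S (f i)"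
  shows "smooth_on S (\<lambda>x. \<Sum>i\<in>I. u i x *\<^sub>R f i x)"
  using assms unfolding smooth_on_def by (auto intro!: Ck_on_sum Ck_on_scaleR)

text \<open>A matrix with smooth columns times a smooth vector. It serves for the differential of a
  map and for an endomorphism field, each applied to a moving vector.\<close>

lemma smooth_on_linear_family:
  fixes l :: "'a::euclidean_space \<Rightarrow> 'b::euclidean_space \<Rightarrow> 'c::euclidean_space"
  assumes S: "open S" and w: "smooth_on S w" and l: "\<And>i. i \<in> Basis \<Longrightarrow> smooth_on S (\<lambda>x. l x i)"
    and lin: "\<And>x. x \<in> S \<Longrightarrow> linear (l x)"
  shows "smooth_on S (\<lambda>x. l x (w x))"
proof -
  have "smooth_on S (\<lambda>x. \<Sum>i\<in>Basis. (w x \<bullet> i) *\<^sub>R l x i)"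
    using w Ck_on_bounded_linear_comp[OF S bounded_linear_inner_left, of _ w]
    by (intro smooth_on_sum_scaleR S l) (auto simp: smooth_on_def)
  then show ?thesis by (rule smooth_on_cong[OF S]) (simp add: linear_sum_Basis[OF lin, symmetric])
qed

section \<open>Symmetry of mixed second derivatives\<close>

text \<open>Both mixed derivatives are limits of the second difference quotient, by applying the mean
  value theorem once in each direction.\<close>

lemma second_difference_mean_value:
  fixes F :: "'a::euclidean_space \<Rightarrow> real"
  assumes h: "0 < h"
    and in_S: "\<And>s t. 0 \<le> s \<Longrightarrow> s \<le> h \<Longrightarrow> 0 \<le> t \<Longrightarrow> t \<le> h \<Longrightarrow> x + s *\<^sub>R a + t *\<^sub>R b \<in> S"
    and F: "smooth_on S F"
  shows "\<exists>s t. 0 \<le> s \<and> s \<le> h \<and> 0 \<le> t \<and> t \<le> h \<and>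
    F (x + h *\<^sub>R a + h *\<^sub>R b) - F (x + h *\<^sub>R a) - F (x + h *\<^sub>R b) + F x =
    h * h * frechet_derivative (\<lambda>y. frechet_derivative F (at y) a) (at (x + s *\<^sub>R a + t *\<^sub>R b)) b"
proof -
  define G where "G = (\<lambda>y. frechet_derivative F (at y) a)"
  have line: "((\<lambda>r. H (y + r *\<^sub>R d)) has_real_derivative frechet_derivative H (at (y + r *\<^sub>R d)) d) (at r)"
    if "smooth_on S H" "y + r *\<^sub>R d \<in> S" for H :: "'a \<Rightarrow> real" and y d r
  proof -
    have "((\<lambda>r. H (y + r *\<^sub>R d)) has_derivative (\<lambda>k. frechet_derivative H (at (y + r *\<^sub>R d)) (k *\<^sub>R d))) (at r)"
      by (rule has_derivative_compose[of "\<lambda>r. y + r *\<^sub>R d", OF _ smooth_on_has_derivative[OF that]])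
        (auto intro!: derivative_eq_intros)
    moreover have "frechet_derivative H (at (y + r *\<^sub>R d)) (k *\<^sub>R d) = frechet_derivative H (at (y + r *\<^sub>R d)) d * k" for k
      using linear_scale[OF linear_frechet_derivative[OF smooth_on_differentiable[OF that]]] by simp
    ultimately show ?thesis by (simp only: has_field_derivative_def)
  qed
  \<comment> \<open>The increment of \<open>F\<close> in direction \<open>b\<close> as a function of
    the displacement along \<open>a\<close>, so that \<open>u h - u 0\<close> is the second
    difference.\<close>
  define u where "u = (\<lambda>s. F ((x + h *\<^sub>R b) + s *\<^sub>R a) - F (x + s *\<^sub>R a))"
  have "(u has_real_derivative (G ((x + h *\<^sub>R b) + s *\<^sub>R a) - G (x + s *\<^sub>R a))) (at s)" if "0 \<le> s" "s \<le> h" for s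
    unfolding u_def G_def using in_S[of s h] in_S[of s 0] that h F
    by (intro DERIV_diff line) (auto simp: algebra_simps)
  from MVT2[OF h, of u, OF this] obtain s where s: "0 < s" "s < h"
    "u h - u 0 = h * (G ((x + h *\<^sub>R b) + s *\<^sub>R a) - G (x + s *\<^sub>R a))" by auto
  have "((\<lambda>t. G ((x + s *\<^sub>R a) + t *\<^sub>R b)) has_real_derivative
      frechet_derivative G (at (x + s *\<^sub>R a + t *\<^sub>R b)) b) (at t)" if "0 \<le> t" "t \<le> h" for t
    using in_S[of s t] that s(1,2) smooth_on_frechet[OF F, of a] by (intro line) (auto simp: G_def)
  from MVT2[OF h, of "\<lambda>t. G ((x + s *\<^sub>R a) + t *\<^sub>R b)", OF this] obtain t where t: "0 < t" "t < h"
    "G ((x + s *\<^sub>R a) + h *\<^sub>R b) - G (x + s *\<^sub>R a) = h * frechet_derivative G (at (x + s *\<^sub>R a + t *\<^sub>R b)) b"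
    by auto
  have "u h - u 0 = h * h * frechet_derivative G (at (x + s *\<^sub>R a + t *\<^sub>R b)) b"
    using s(3) t(3) by (simp add: algebra_simps)
  then show ?thesis
    using s t by (intro exI[of _ s] exI[of _ t]) (simp add: u_def G_def algebra_simps)
qed

lemma second_derivative_symmetric_real:
  fixes F :: "'a::euclidean_space \<Rightarrow> real"
  assumes "open S" "x \<in> S" and F: "smooth_on S F"
  shows "frechet_derivative (\<lambda>y. frechet_derivative F (at y) a) (at x) b =
    frechet_derivative (\<lambda>y. frechet_derivative F (at y) b) (at x) a"
proof -
  define D where "D = (\<lambda>a b y. frechet_derivative (\<lambda>y. frechet_derivative F (at y) a) (at y) b)"
  obtain r where r: "r > 0" "cball x r \<subseteq> S" using \<open>open S\<close> \<open>x \<in> S\<close> open_contains_cball by blast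
  have "\<bar>D a b x - D b a x\<bar> \<le> e" if "e > 0" for e
  proof -
    have cont: "continuous (at x) (D a b)" for a b
      using smooth_on_differentiable[OF smooth_on_frechet[OF smooth_on_frechet[OF F, of a], of b] \<open>x \<in> S\<close>]
        differentiable_imp_continuous_within unfolding D_def by blast
    obtain d1 where d1: "d1 > 0" "\<And>y. dist y x < d1 \<Longrightarrow> \<bar>D a b y - D a b x\<bar> < e / 2"
      using cont[of a b] \<open>e > 0\<close> unfolding continuous_at_eps_delta
      by (metis dist_real_def half_gt_zero)
    obtain d2 where d2: "d2 > 0" "\<And>y. dist y x < d2 \<Longrightarrow> \<bar>D b a y - D b a x\<bar> < e / 2"
      using cont[of b a] \<open>e > 0\<close> unfolding continuous_at_eps_delta
      by (metis dist_real_def half_gt_zero)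
    \<comment> \<open>Halving makes \<open>q\<close> strictly smaller than all three radii. Dividing
      by \<open>norm a + norm b + 1\<close> below keeps the whole parallelogram with sides
      \<open>h *\<^sub>R a\<close> and \<open>h *\<^sub>R b\<close> within \<open>q\<close> of
      \<open>x\<close>; the summand 1 covers the case \<open>a = b = 0\<close>.\<close>
    define q where "q = min r (min d1 d2) / 2"
    have q: "q > 0" "q < r" "q < d1" "q < d2" using r d1 d2 by (auto simp: q_def min_def)
    define h where "h = q / (norm a + norm b + 1)"
    have h: "h > 0" using q by (simp add: h_def add_nonneg_pos)
    have small: "norm (s *\<^sub>R a + t *\<^sub>R b) \<le> q" if "0 \<le> s" "s \<le> h" "0 \<le> t" "t \<le> h" for s t
    proof -
      have "norm (s *\<^sub>R a + t *\<^sub>R b) \<le> s * norm a + t * norm b"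
        using norm_triangle_ineq[of "s *\<^sub>R a" "t *\<^sub>R b"] that by simp
      also have "\<dots> \<le> h * norm a + h * norm b"
        using that by (intro add_mono mult_right_mono) auto
      also have "\<dots> \<le> h * (norm a + norm b + 1)" using h by (simp add: algebra_simps)
      also have "\<dots> = q" unfolding h_def
        by (metis add_nonneg_pos add_nonneg_nonneg norm_ge_zero less_irrefl nonzero_eq_divide_eq zero_less_one)
      finally show ?thesis .
    qed
    have dist_small: "dist (x + s *\<^sub>R a + t *\<^sub>R b) x \<le> q" if "0 \<le> s" "s \<le> h" "0 \<le> t" "t \<le> h" for s t
      using small[OF that] by (simp add: dist_norm add.assoc)
    have inS1: "x + s *\<^sub>R a + t *\<^sub>R b \<in> S" if "0 \<le> s" "s \<le> h" "0 \<le> t" "t \<le> h" for s t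
      using dist_small[OF that] q r(2) by (auto simp: dist_commute subset_iff)
    have inS2: "x + s *\<^sub>R b + t *\<^sub>R a \<in> S" if "0 \<le> s" "s \<le> h" "0 \<le> t" "t \<le> h" for s t
      using inS1[of t s] that by (simp add: algebra_simps)
    obtain s t where st: "0 \<le> s" "s \<le> h" "0 \<le> t" "t \<le> h"
      "F (x + h *\<^sub>R a + h *\<^sub>R b) - F (x + h *\<^sub>R a) - F (x + h *\<^sub>R b) + F x = h * h * D a b (x + s *\<^sub>R a + t *\<^sub>R b)"
      using second_difference_mean_value[OF h inS1 F] unfolding D_def by blast
    obtain s' t' where st': "0 \<le> s'" "s' \<le> h" "0 \<le> t'" "t' \<le> h"
      "F (x + h *\<^sub>R b + h *\<^sub>R a) - F (x + h *\<^sub>R b) - F (x + h *\<^sub>R a) + F x = h * h * D b a (x + s' *\<^sub>R b + t' *\<^sub>R a)"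
      using second_difference_mean_value[OF h inS2 F] unfolding D_def by blast
    \<comment> \<open>The second difference does not distinguish the order of \<open>a\<close> and
      \<open>b\<close>, so the two mixed derivatives agree, though at two different points near
      \<open>x\<close>; continuity moves both points to \<open>x\<close>.\<close>
    have "h * h * D a b (x + s *\<^sub>R a + t *\<^sub>R b) = h * h * D b a (x + s' *\<^sub>R b + t' *\<^sub>R a)"
      using st(5) st'(5) by (simp add: algebra_simps)
    then have "D a b (x + s *\<^sub>R a + t *\<^sub>R b) = D b a (x + t' *\<^sub>R a + s' *\<^sub>R b)"
      using h by (simp add: algebra_simps)
    moreover have "\<bar>D a b (x + s *\<^sub>R a + t *\<^sub>R b) - D a b x\<bar> < e / 2"
      using dist_small[OF st(1-4)] q by (intro d1) auto
    moreover have "\<bar>D b a (x + t' *\<^sub>R a + s' *\<^sub>R b) - D b a x\<bar> < e / 2"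
      using dist_small[OF st'(3,4,1,2)] q by (intro d2) auto
    ultimately show ?thesis by linarith
  qed
  then have "\<bar>D a b x - D b a x\<bar> \<le> 0" by (rule field_le_epsilon) auto
  then show ?thesis by (simp add: D_def)
qed

lemma second_derivative_symmetric:
  fixes F :: "'a::euclidean_space \<Rightarrow> 'b::euclidean_space"
  assumes S: "open S" "x \<in> S" and F: "smooth_on S F"
  shows "frechet_derivative (\<lambda>y. frechet_derivative F (at y) a) (at x) b =
    frechet_derivative (\<lambda>y. frechet_derivative F (at y) b) (at x) a"
proof (rule euclidean_eqI)
  fix i :: 'b
  have comp: "frechet_derivative (\<lambda>y. H y \<bullet> i) (at y) v = frechet_derivative H (at y) v \<bullet> i"
    if "smooth_on S H" "y \<in> S" for H :: "'a \<Rightarrow> 'b" and y v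
    using frechet_derivative_at[OF bounded_linear.has_derivative[OF bounded_linear_inner_left
          smooth_on_has_derivative[OF that]], of i] by metis
  have Fi: "smooth_on S (\<lambda>y. F y \<bullet> i)"
    using F Ck_on_bounded_linear_comp[OF S(1) bounded_linear_inner_left] by (auto simp: smooth_on_def)
  have "frechet_derivative (\<lambda>y. frechet_derivative F (at y) v) (at x) w \<bullet> i =
      frechet_derivative (\<lambda>y. frechet_derivative (\<lambda>y. F y \<bullet> i) (at y) v) (at x) w" for v w
    using comp[OF smooth_on_frechet[OF F, of v] S(2), of w]
      frechet_derivative_cong_open[OF S, of "\<lambda>y. frechet_derivative F (at y) v \<bullet> i"
        "\<lambda>y. frechet_derivative (\<lambda>y. F y \<bullet> i) (at y) v"] comp[OF F, of _ v] by simp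
  then show "frechet_derivative (\<lambda>y. frechet_derivative F (at y) a) (at x) b \<bullet> i =
    frechet_derivative (\<lambda>y. frechet_derivative F (at y) b) (at x) a \<bullet> i"
    using second_derivative_symmetric_real[OF S Fi] by simp
qed

section \<open>Positive definite forms and the pointwise identity\<close>

text \<open>The metric at a point is a form on the model space unrelated to the inner product of
  that type, so orthonormal bases and Riesz representatives are taken with respect to an arbitrary
  positive definite form.\<close>

locale inner_form =
  fixes b :: "'v::euclidean_space \<Rightarrow> 'v \<Rightarrow> real"
  assumes bilin: "bilinear b"
    and sym: "b v w = b w v"
    and pos: "v \<noteq> 0 \<Longrightarrow> b v v > 0"
begin

definition orthonormal :: "'v set \<Rightarrow> bool" where
  "orthonormal E \<longleftrightarrow> finite E \<and> (\<forall>x\<in>E. \<forall>y\<in>E. b x y = (if x = y then 1 else 0))"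

lemma linear_left: "linear (\<lambda>v. b v w)" and linear_right: "linear (b v)"
  using bilin by (auto simp: bilinear_def)

lemmas left_simps = linear_add[OF linear_left] linear_diff[OF linear_left]
  linear_scale[OF linear_left] linear_neg[OF linear_left] linear_sum[OF linear_left] linear_0[OF linear_left]

lemmas right_simps = linear_add[OF linear_right] linear_diff[OF linear_right]
  linear_scale[OF linear_right] linear_neg[OF linear_right] linear_sum[OF linear_right] linear_0[OF linear_right]

lemma eq_0_iff: "b v v = 0 \<longleftrightarrow> v = 0"
  using pos[of v] left_simps(6) by fastforce

lemma eqI: assumes "\<And>y. b v y = b w y" shows "v = w"
proof -
  have "b (v - w) (v - w) = 0" using assms[of "v - w"] by (simp add: left_simps)
  then show ?thesis by (simp add: eq_0_iff)
qed

lemma orthonormal_sum: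
  assumes "orthonormal E" "e \<in> E" shows "b (\<Sum>d\<in>E. c d *\<^sub>R d) e = c e"
proof -
  have "b (\<Sum>d\<in>E. c d *\<^sub>R d) e = (\<Sum>d\<in>E. c d * b d e)" by (simp add: left_simps)
  also have "\<dots> = (\<Sum>d\<in>E. if d = e then c d else 0)"
    using assms by (intro sum.cong) (auto simp: orthonormal_def)
  finally show ?thesis using assms by (simp add: orthonormal_def)
qed

lemma orthonormal_expansion:
  assumes "orthonormal E" "x \<in> span E" shows "x = (\<Sum>e\<in>E. b x e *\<^sub>R e)"
proof -
  obtain c where "x = (\<Sum>e\<in>E. c e *\<^sub>R e)"
    using assms by (auto simp: orthonormal_def span_finite)
  with orthonormal_sum[OF assms(1)] show ?thesis by (auto intro!: sum.cong)
qed

text \<open>Gram-Schmidt, one vector at a time. A vector whose orthogonal remainder \<open>w\<close>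
  vanishes is dropped, so \<open>S\<close> may be linearly dependent.\<close>

lemma orthonormal_exists:
  assumes "finite S" shows "\<exists>E. orthonormal E \<and> span E = span S"
  using assms
proof induction
  case empty
  show ?case by (rule exI[of _ "{}"]) (simp add: orthonormal_def)
next
  case (insert v S)
  then obtain E where E: "orthonormal E" "span E = span S" by blast
  define w where "w = v - (\<Sum>e\<in>E. b v e *\<^sub>R e)"
  have sum_in: "(\<Sum>e\<in>E. b v e *\<^sub>R e) \<in> span E" by (intro span_sum span_scale span_base)
  have w_orth: "b w e = 0" if "e \<in> E" for e
    using orthonormal_sum[OF E(1) that, of "b v"] by (simp add: w_def left_simps)
  have span_v: "span (insert v S) = span (insert v E)" using E by (simp add: span_insert)
  show ?case
  proof (cases "w = 0")
    case True
    then have "v \<in> span E" using sum_in by (simp add: w_def)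
    then show ?thesis using E span_v by (auto simp: span_redundant)
  next
    case False
    define r where "r = sqrt (b w w)"
    have r: "r > 0" "b w w = r * r" using pos[OF False] by (simp_all add: r_def)
    define u where "u = (1 / r) *\<^sub>R w"
    have uu: "b u u = 1" using r by (simp add: u_def left_simps right_simps field_simps)
    have ue: "b u e = 0" "b e u = 0" if "e \<in> E" for e
      using w_orth[OF that] sym[of e w] by (simp_all add: u_def left_simps right_simps)
    have "orthonormal (insert u E)"
      using E(1) uu ue unfolding orthonormal_def by auto
    moreover have "span (insert u E) = span (insert v E)"
    proof -
      have mono: "(\<Sum>e\<in>E. b v e *\<^sub>R e) \<in> span (insert y E)" for y
        using sum_in span_mono[OF subset_insertI] by blast
      have "w \<in> span (insert v E)" unfolding w_def
        by (intro span_diff mono) (simp add: span_base)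
      then have "u \<in> span (insert v E)" unfolding u_def by (rule span_scale)
      moreover have "v \<in> span (insert u E)"
      proof -
        have "v = r *\<^sub>R u + (\<Sum>e\<in>E. b v e *\<^sub>R e)" using r by (simp add: u_def w_def)
        also have "\<dots> \<in> span (insert u E)"
          by (intro span_add mono span_scale) (simp add: span_base)
        finally show ?thesis .
      qed
      ultimately show ?thesis by (auto simp: span_eq intro: span_base)
    qed
    ultimately show ?thesis using span_v by auto
  qed
qed

lemma orthonormal_basis_exists: "\<exists>E. orthonormal E \<and> span E = UNIV"
  using orthonormal_exists[OF finite_Basis] by simp

text \<open>Unique existence is what the definite description in \<open>shape_operator\<close>
  requires; the representative also supplies the tangential part of a vector in
  \<open>normal_component_ex1\<close>.\<close>

lemma riesz:
  assumes "linear l" shows "\<exists>!z. \<forall>y. b z y = l y"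
proof -
  obtain E where E: "orthonormal E" "span E = UNIV" using orthonormal_basis_exists by blast
  have "b (\<Sum>e\<in>E. l e *\<^sub>R e) y = l y" for y
    using arg_cong[OF orthonormal_expansion[OF E(1), of y], of l] E(2) sym[of y]
    by (simp add: left_simps linear_sum[OF assms] linear_scale[OF assms] mult.commute)
  then show ?thesis by (metis eqI)
qed

end

text \<open>The coordinate basis is in general not orthonormal for \<open>b\<close>. Expanding each
  \<open>axis i 1\<close> in \<open>E\<close> and exchanging the two sums reassembles
  \<open>A e\<close> from its coordinates.\<close>

lemma trace_orthonormal:
  fixes b :: "real^'n \<Rightarrow> real^'n \<Rightarrow> real"
  assumes "inner_form b" "inner_form.orthonormal b E" "span E = UNIV" "linear A"
  shows "trace (matrix A) = (\<Sum>e\<in>E. b (A e) e)"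
proof -
  interpret inner_form b by fact
  have "trace (matrix A) = (\<Sum>i\<in>UNIV. A (axis i 1) $ i)"
    by (simp add: trace_def matrix_def)
  also have "\<dots> = (\<Sum>i\<in>UNIV. \<Sum>e\<in>E. b (axis i 1) e * (A e $ i))"
  proof (rule sum.cong[OF refl])
    fix i :: 'n
    have "A (axis i 1) = (\<Sum>e\<in>E. b (axis i 1) e *\<^sub>R A e)"
      using arg_cong[OF orthonormal_expansion[OF assms(2), of "axis i 1"], of A] assms(3)
      by (simp add: linear_sum[OF assms(4)] linear_scale[OF assms(4)])
    then have "A (axis i 1) $ i = (\<Sum>e\<in>E. b (axis i 1) e *\<^sub>R A e) $ i" by (rule arg_cong)
    then show "A (axis i 1) $ i = (\<Sum>e\<in>E. b (axis i 1) e * (A e $ i))"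
      by simp
  qed
  also have "\<dots> = (\<Sum>e\<in>E. b (\<Sum>i\<in>UNIV. (A e $ i) *\<^sub>R axis i 1) e)"
    by (subst sum.swap) (simp add: left_simps mult.commute)
  also have "\<dots> = (\<Sum>e\<in>E. b (A e) e)"
  proof -
    have "(\<Sum>i\<in>UNIV. (v $ i) *\<^sub>R axis i 1) = v" for v :: "real^'n"
      by (simp add: scalar_mult_eq_scaleR[symmetric] basis_expansion)
    then show ?thesis by simp
  qed
  finally show ?thesis .
qed

section \<open>Linear algebra of one Lagrangian tangent space\<close>

text \<open>The tangent space \<open>range L\<close> of a Lagrangian submanifold at one point.\<close>

locale lagrangian_point = inner_form G
  for G :: "'e::euclidean_space \<Rightarrow> 'e \<Rightarrow> real" +
  fixes I :: "'e \<Rightarrow> 'e" and L :: "'v::euclidean_space \<Rightarrow> 'e"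
  assumes linear_I: "linear I" and I_I: "I (I v) = - v" and I_isom: "G (I v) (I w) = G v w"
    and linear_L: "linear L" and inj_L: "inj L"
    and normal: "I ` range L = {\<xi>. \<forall>w\<in>range L. G \<xi> w = 0}"
begin

definition b where "b x y = G (L x) (L y)"

lemma inner_form_b: "inner_form b"
proof
  show "bilinear b"
    unfolding bilinear_def b_def
    using linear_compose[OF linear_L linear_left] linear_compose[OF linear_L linear_right]
    by (auto simp: o_def)
  show "b v w = b w v" for v w by (simp add: b_def sym)
  show "b v v > 0" if "v \<noteq> 0" for v
    using that inj_L linear_0[OF linear_L] unfolding b_def by (metis injD pos)
qed

sublocale t: inner_form b by (rule inner_form_b)

lemma G_I_L: "G (I (L x)) (L y) = 0"
proof -
  have "I (L x) \<in> I ` range L" by blast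
  then show ?thesis unfolding normal by blast
qed

lemma inj_IL: "I (L x) = I (L y) \<longleftrightarrow> x = y"
  using I_I inj_L by (metis injD minus_minus)

lemma linear_IL: "linear (\<lambda>x. I (L x))"
  using linear_compose[OF linear_L linear_I] by (simp add: o_def)

lemma G_skew: "G (I v) w = - G v (I w)"
  using I_isom[of "I v" w] by (simp add: I_I left_simps)

text \<open>The tangential part of \<open>w\<close> is \<open>L z\<close>, where \<open>z\<close>
  represents the functional \<open>\<lambda>y. G w (L y)\<close> in the induced form
  \<open>b\<close>; what remains is normal.\<close>

lemma normal_component_ex1:
  "\<exists>!\<xi>. \<xi> \<in> {\<xi>. \<forall>w\<in>range L. G \<xi> w = 0} \<and> w - \<xi> \<in> range L"
proof -
  have "linear (\<lambda>y. G w (L y))" using linear_compose[OF linear_L linear_right] by (simp add: o_def)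
  from t.riesz[OF this] obtain z where z: "\<And>y. G (L z) (L y) = G w (L y)" by (auto simp: b_def)
  show ?thesis
  proof (rule ex1I[of _ "w - L z"])
    show "w - L z \<in> {\<xi>. \<forall>w\<in>range L. G \<xi> w = 0} \<and> w - (w - L z) \<in> range L"
      using z by (auto simp: left_simps)
    fix \<xi> assume \<xi>: "\<xi> \<in> {\<xi>. \<forall>w\<in>range L. G \<xi> w = 0} \<and> w - \<xi> \<in> range L"
    then obtain y where "w - \<xi> = L y" by auto
    moreover have "y = z"
    proof (rule t.eqI)
      fix u show "b y u = b z u"
        using \<xi> z[of u] \<open>w - \<xi> = L y\<close>[symmetric] by (simp add: b_def left_simps)
    qed
    ultimately show "\<xi> = w - L z" by (metis diff_diff_eq2 add_diff_cancel_left')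
  qed
qed

text \<open>\<open>I\<close> maps the tangent space isometrically onto the normal space, so a normal
  orthonormal basis comes from a tangential one. This puts the sum over normals and the trace over
  tangent vectors on one index set.\<close>

lemma normal_orthonormal_basis:
  assumes "finite B" "span B = I ` range L" "\<And>\<xi> \<eta>. \<xi> \<in> B \<Longrightarrow> \<eta> \<in> B \<Longrightarrow> G \<xi> \<eta> = (if \<xi> = \<eta> then 1 else 0)"
  obtains E where "B = (\<lambda>x. I (L x)) ` E" "t.orthonormal E" "span E = UNIV"
proof -
  define E where "E = {e. I (L e) \<in> B}"
  have B: "B = (\<lambda>x. I (L x)) ` E"
    using span_superset[of B] unfolding assms(2) E_def by auto
  have inj: "inj (\<lambda>x. I (L x))" by (simp add: inj_IL inj_def)
  have "finite E" using assms(1) unfolding B by (rule finite_imageD) (use inj inj_on_subset in blast)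
  moreover have "b x y = (if x = y then 1 else 0)" if "x \<in> E" "y \<in> E" for x y
    using assms(3)[of "I (L x)" "I (L y)"] that by (simp add: E_def b_def I_isom inj_IL)
  moreover have "span E = UNIV"
  proof -
    have "(\<lambda>x. I (L x)) ` span E = range (\<lambda>x. I (L x))"
      using linear_span_image[OF linear_IL, of E] assms(2) unfolding B by (simp add: image_image)
    then show ?thesis using inj by (metis inj_image_eq_iff)
  qed
  ultimately show ?thesis using that B by (simp add: t.orthonormal_def)
qed

text \<open>Guarantees that the basis selected by \<open>SOME\<close> in the two operators really is
  one.\<close>

lemma normal_orthonormal_basis_exists:
  "\<exists>B. finite B \<and> span B = I ` range L \<and> (\<forall>\<xi>\<in>B. \<forall>\<eta>\<in>B. G \<xi> \<eta> = (if \<xi> = \<eta> then 1 else 0))"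
proof -
  obtain E where E: "t.orthonormal E" "span E = UNIV" using t.orthonormal_basis_exists by blast
  then show ?thesis
    by (intro exI[of _ "(\<lambda>x. I (L x)) ` E"])
      (auto simp: t.orthonormal_def linear_span_image[OF linear_IL] I_isom inj_IL image_image b_def)
qed

end

text \<open>The shape operators satisfy \<open>A\<^bsub>I L x\<^esub> y = A\<^bsub>I L y\<^esub> x\<close> because \<open>G (h x y) (I (L z))\<close> is totally
  symmetric. Hence both sides have the component
  \<open>(\<Sum>e. b (A\<^bsub>I L x\<^esub> e) (A\<^bsub>I L d\<^esub> e))\<close> in the direction of \<open>I (L d)\<close>.\<close>

lemma sum_trace_eq_sum_squares:
  fixes L :: "real^'n \<Rightarrow> 'e::euclidean_space"
  assumes "lagrangian_point G I L"
    and sym12: "\<And>x y z. G (h x y) (I (L z)) = G (h y x) (I (L z))"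
    and sym23: "\<And>x y z. G (h x y) (I (L z)) = G (h x z) (I (L y))"
    and A: "\<And>\<xi> x. A \<xi> x = (THE z. \<forall>y. G (L z) (L y) = G (h x y) \<xi>)"
    and B: "finite B" "span B = I ` range L"
      "\<And>\<xi> \<eta>. \<xi> \<in> B \<Longrightarrow> \<eta> \<in> B \<Longrightarrow> G \<xi> \<eta> = (if \<xi> = \<eta> then 1 else 0)"
  shows "(\<Sum>\<xi>\<in>B. trace (matrix (A (I (L x)) \<circ> A \<xi>)) *\<^sub>R \<xi>) = I (L (\<Sum>\<xi>\<in>B. A \<xi> (A \<xi> x)))"
proof -
  interpret lagrangian_point G I L by fact
  define S where "S d = A (I (L d))" for d
  have cubic: "b (S d x) y = G (h x y) (I (L d))" for d x y
  proof -
    \<comment> \<open>\<open>h\<close> is not assumed linear; \<open>sym23\<close> moves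
      \<open>y\<close> into the slot \<open>I (L y)\<close>, where linearity is evident.\<close>
    have "linear (\<lambda>y. G (h x y) (I (L d)))"
      unfolding sym23[of x _ d] using linear_compose[OF linear_IL linear_right] by (simp add: o_def)
    from theI'[OF t.riesz[OF this]] show ?thesis unfolding S_def A b_def by blast
  qed
  have comm: "S d x = S x d" for d x
    by (rule t.eqI) (metis cubic sym12 sym23)
  have self_adjoint: "b (S d x) y = b x (S d y)" for d x y
    using cubic[of d x y] cubic[of d y x] sym12[of x y d] by (simp add: t.sym)
  \<comment> \<open>Self-adjointness moves the argument of \<open>S d\<close> out of the operator,
    so linearity follows from nondegeneracy of \<open>b\<close>.\<close>
  have linear_S: "linear (S d)" for d
  proof (rule linearI)
    show "S d (x + y) = S d x + S d y" for x y
      by (rule t.eqI) (simp add: self_adjoint t.left_simps)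
    show "S d (r *\<^sub>R x) = r *\<^sub>R S d x" for r x
      by (rule t.eqI) (simp add: self_adjoint t.left_simps)
  qed
  obtain E where E: "B = (\<lambda>x. I (L x)) ` E" "t.orthonormal E" "span E = UNIV"
    using normal_orthonormal_basis[OF B] by blast
  have inj: "inj_on (\<lambda>x. I (L x)) E" by (simp add: inj_IL inj_on_def)
  define R where "R = (\<Sum>e\<in>E. S e (S e x))"
  have "trace (matrix (S x \<circ> S d)) = b R d" for d
  proof -
    have "trace (matrix (S x \<circ> S d)) = (\<Sum>e\<in>E. b (S x (S d e)) e)"
      using trace_orthonormal[OF inner_form_b E(2,3) linear_compose[OF linear_S linear_S]]
      by (simp add: o_def)
    \<comment> \<open>Self-adjointness of \<open>S x\<close>, then \<open>S x e = S e x\<close> and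
      \<open>S d e = S e d\<close>, then self-adjointness of \<open>S e\<close>.\<close>
    also have "\<dots> = (\<Sum>e\<in>E. b (S e (S e x)) d)"
      by (intro sum.cong refl) (metis comm self_adjoint t.sym)
    finally show ?thesis by (simp add: R_def t.left_simps)
  qed
  then have "(\<Sum>\<xi>\<in>B. trace (matrix (A (I (L x)) \<circ> A \<xi>)) *\<^sub>R \<xi>) = (\<Sum>e\<in>E. b R e *\<^sub>R I (L e))"
    unfolding E(1) sum.reindex[OF inj] S_def by simp
  also have "\<dots> = I (L R)"
    using t.orthonormal_expansion[OF E(2), of R] E(3)
      linear_sum[OF linear_IL, of "\<lambda>e. b R e *\<^sub>R e" E] linear_scale[OF linear_IL] by simp
  also have "R = (\<Sum>\<xi>\<in>B. A \<xi> (A \<xi> x))"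
    unfolding E(1) sum.reindex[OF inj] S_def R_def by simp
  finally show ?thesis .
qed

section \<open>Charts\<close>

locale smooth_mfd =
  fixes M :: "('p, 'v::euclidean_space) manifold"
  assumes smooth_manifold: "smooth_manifold M"
begin

text \<open>The tangent map of the coordinate change from \<open>\<phi>\<close> to \<open>\<psi>\<close> at \<open>q\<close>; both \<^const>\<open>comps\<close> and
  \<^const>\<open>const_field\<close> are of this form.\<close>

definition jac :: "('p, 'v) chart \<Rightarrow> ('p, 'v) chart \<Rightarrow> 'p \<Rightarrow> 'v \<Rightarrow> 'v" where
  "jac \<phi> \<psi> q = frechet_derivative (coord \<psi> \<circ> param \<phi>) (at (coord \<phi> q))"

lemma comps_jac: "comps M \<psi> q = jac (chart_at M q) \<psi> q"
  and const_field_jac: "const_field M \<phi> v q = jac \<phi> (chart_at M q) q v"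
  by (auto simp: comps_def const_field_def jac_def fun_eq_iff)

lemma chart_at: assumes "p \<in> points M" shows "chart_at M p \<in> atlas M" "p \<in> dom (chart_at M p)"
proof -
  have "\<exists>\<phi>. \<phi> \<in> atlas M \<and> p \<in> dom \<phi>"
    using assms smooth_manifold by (auto simp: smooth_manifold_def)
  from someI_ex[OF this] show "chart_at M p \<in> atlas M" "p \<in> dom (chart_at M p)"
    unfolding chart_at_def by auto
qed

lemma openin_dom: "\<phi> \<in> atlas M \<Longrightarrow> openin (man_top M) (dom \<phi>)"
  using smooth_manifold by (auto simp: smooth_manifold_def)

lemma dom_points: "\<phi> \<in> atlas M \<Longrightarrow> q \<in> dom \<phi> \<Longrightarrow> q \<in> points M"
  using openin_dom openin_subset by blast

lemma param_coord: "\<phi> \<in> atlas M \<Longrightarrow> q \<in> dom \<phi> \<Longrightarrow> param \<phi> (coord \<phi> q) = q"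
proof -
  assume \<phi>: "\<phi> \<in> atlas M" and q: "q \<in> dom \<phi>"
  have "homeomorphic_map (subtopology (man_top M) (dom \<phi>)) (top_of_set (coord \<phi> ` dom \<phi>)) (coord \<phi>)"
    using \<phi> smooth_manifold unfolding smooth_manifold_def by blast
  then have "inj_on (coord \<phi>) (topspace (subtopology (man_top M) (dom \<phi>)))"
    by (simp only: homeomorphic_eq_everything_map)
  moreover have "topspace (subtopology (man_top M) (dom \<phi>)) = dom \<phi>"
    using dom_points[OF \<phi>] by auto
  ultimately show ?thesis using q by (simp add: param_def)
qed

lemma open_coord_image:
  assumes "\<phi> \<in> atlas M" "openin (man_top M) U" shows "open (coord \<phi> ` (dom \<phi> \<inter> U))"
proof -
  have "homeomorphic_map (subtopology (man_top M) (dom \<phi>)) (top_of_set (coord \<phi> ` dom \<phi>)) (coord \<phi>)"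
    and op: "open (coord \<phi> ` dom \<phi>)"
    using assms(1) smooth_manifold unfolding smooth_manifold_def by blast+
  then have "open_map (subtopology (man_top M) (dom \<phi>)) (top_of_set (coord \<phi> ` dom \<phi>)) (coord \<phi>)"
    by (simp only: homeomorphic_eq_everything_map)
  moreover have "openin (subtopology (man_top M) (dom \<phi>)) (dom \<phi> \<inter> U)"
    using assms(2) by (auto simp: openin_subtopology)
  ultimately have "openin (top_of_set (coord \<phi> ` dom \<phi>)) (coord \<phi> ` (dom \<phi> \<inter> U))"
    unfolding open_map_def by blast
  then show ?thesis using op openin_open_trans by blast
qed

lemma open_coord_dom: "\<phi> \<in> atlas M \<Longrightarrow> open (coord \<phi> ` dom \<phi>)"
  using open_coord_image[OF _ openin_topspace, of \<phi>] dom_points[of \<phi>]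
  by (metis inf.absorb1 subsetI)

lemma smooth_transition:
  "\<phi> \<in> atlas M \<Longrightarrow> \<psi> \<in> atlas M \<Longrightarrow> smooth_on (coord \<phi> ` (dom \<phi> \<inter> dom \<psi>)) (coord \<psi> \<circ> param \<phi>)"
  using smooth_manifold by (auto simp: smooth_manifold_def)

lemma jac_has_derivative:
  assumes "\<phi> \<in> atlas M" "\<psi> \<in> atlas M" "q \<in> dom \<phi>" "q \<in> dom \<psi>"
  shows "((coord \<psi> \<circ> param \<phi>) has_derivative jac \<phi> \<psi> q) (at (coord \<phi> q))"
  unfolding jac_def using smooth_on_has_derivative[OF smooth_transition[OF assms(1,2)]] assms(3,4) by blast

lemma linear_jac:
  assumes "\<phi> \<in> atlas M" "\<psi> \<in> atlas M" "q \<in> dom \<phi>" "q \<in> dom \<psi>" shows "linear (jac \<phi> \<psi> q)"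
  using has_derivative_linear[OF jac_has_derivative[OF assms]] .

text \<open>The chain rule for the transition map. The two coordinate expressions of
  \<open>u\<close> are related by it only on the overlap of the charts, hence the passage through an
  open set.\<close>

lemma chart_change_has_derivative:
  assumes \<phi>: "\<phi> \<in> atlas M" "q \<in> dom \<phi>" and \<theta>: "\<theta> \<in> atlas M" "q \<in> dom \<theta>"
    and u: "((u \<circ> param \<theta>) has_derivative D) (at (coord \<theta> q))"
  shows "((u \<circ> param \<phi>) has_derivative (\<lambda>v. D (jac \<phi> \<theta> q v))) (at (coord \<phi> q))"
proof -
  have eq: "(coord \<theta> \<circ> param \<phi>) (coord \<phi> q) = coord \<theta> q" using param_coord[OF \<phi>] by simp
  have "((\<lambda>a. (u \<circ> param \<theta>) ((coord \<theta> \<circ> param \<phi>) a)) has_derivative (\<lambda>v. D (jac \<phi> \<theta> q v))) (at (coord \<phi> q))"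
    by (rule has_derivative_compose[OF jac_has_derivative[OF \<phi>(1) \<theta>(1) \<phi>(2) \<theta>(2)]]) (simp only: eq u)
  then show ?thesis
  proof (rule has_derivative_transform_within_open)
    show "open (coord \<phi> ` (dom \<phi> \<inter> dom \<theta>))" using open_coord_image \<phi>(1) openin_dom \<theta>(1) by blast
    show "coord \<phi> q \<in> coord \<phi> ` (dom \<phi> \<inter> dom \<theta>)" using \<phi> \<theta> by blast
  qed (use param_coord[OF \<phi>(1)] param_coord[OF \<theta>(1)] in auto)
qed

lemma chart_change_frechet:
  assumes "\<phi> \<in> atlas M" "q \<in> dom \<phi>" "\<theta> \<in> atlas M" "q \<in> dom \<theta>"
    and "(u \<circ> param \<theta>) differentiable (at (coord \<theta> q))"
  shows "frechet_derivative (u \<circ> param \<phi>) (at (coord \<phi> q)) v =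
    frechet_derivative (u \<circ> param \<theta>) (at (coord \<theta> q)) (jac \<phi> \<theta> q v)"
  using frechet_derivative_at[OF chart_change_has_derivative[OF assms(1-4)
        frechet_derivative_has_derivative[OF assms(5)]]] by metis

text \<open>The cocycle rule, obtained by changing charts for the function
  \<open>coord \<psi>\<close>. Together with \<open>jac_refl\<close> it makes \<open>comps\<close>
  and \<open>const_field\<close> inverse to each other.\<close>

lemma jac_chain:
  assumes "\<phi> \<in> atlas M" "q \<in> dom \<phi>" "\<theta> \<in> atlas M" "q \<in> dom \<theta>" "\<psi> \<in> atlas M" "q \<in> dom \<psi>"
  shows "jac \<theta> \<psi> q (jac \<phi> \<theta> q v) = jac \<phi> \<psi> q v"
  using chart_change_frechet[OF assms(1-4), of "coord \<psi>" v]
    jac_has_derivative[OF assms(3,5,4,6)] unfolding jac_def differentiable_def by metis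

lemma jac_refl: assumes "\<phi> \<in> atlas M" "q \<in> dom \<phi>" shows "jac \<phi> \<phi> q v = v"
proof -
  have "((\<lambda>a. a) has_derivative (\<lambda>v. v)) (at (coord \<phi> q))" by (rule has_derivative_ident)
  then have "((coord \<phi> \<circ> param \<phi>) has_derivative (\<lambda>v. v)) (at (coord \<phi> q))"
    by (rule has_derivative_transform_within_open[OF _ open_coord_dom[OF assms(1)]])
      (use assms param_coord[OF assms(1)] in auto)
  from frechet_derivative_at[OF this] show ?thesis unfolding jac_def by metis
qed

context
  fixes \<phi> q assumes \<phi>: "\<phi> \<in> atlas M" "q \<in> dom \<phi>"
begin

lemma chart_at_dom: "chart_at M q \<in> atlas M" "q \<in> dom (chart_at M q)"
  using chart_at dom_points[OF \<phi>] by auto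

lemma linear_comps: "linear (comps M \<phi> q)"
  and linear_const_field: "linear (\<lambda>v. const_field M \<phi> v q)"
  using linear_jac \<phi> chart_at_dom by (auto simp: comps_jac const_field_jac)

lemma comps_const_field:
  assumes "\<psi> \<in> atlas M" "q \<in> dom \<psi>" shows "comps M \<psi> q (const_field M \<phi> v q) = jac \<phi> \<psi> q v"
  using jac_chain[OF \<phi> chart_at_dom assms] by (simp add: comps_jac const_field_jac)

lemma comps_const_field_same: "comps M \<phi> q (const_field M \<phi> v q) = v"
  using comps_const_field[OF \<phi>] jac_refl[OF \<phi>] by simp

lemma const_field_comps: "const_field M \<phi> (comps M \<phi> q v) q = v"
  using jac_chain[OF chart_at_dom \<phi> chart_at_dom] jac_refl[OF chart_at_dom]
  by (simp add: comps_jac const_field_jac)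

end

lemma comps_chart_at: "p \<in> points M \<Longrightarrow> comps M (chart_at M p) p v = v"
  and const_field_chart_at: "p \<in> points M \<Longrightarrow> const_field M (chart_at M p) v p = v"
  using chart_at jac_refl by (auto simp: comps_jac const_field_jac)

text \<open>Smoothness on \<open>U\<close> is quantified over the whole atlas; since transition maps
  are smooth, one chart containing \<open>U\<close> suffices.\<close>

lemma smooth_chart_change:
  assumes \<phi>: "\<phi> \<in> atlas M" and \<theta>: "\<theta> \<in> atlas M" and U: "openin (man_top M) U" "U \<subseteq> dom \<theta>"
    and u: "smooth_on (coord \<theta> ` U) (u \<circ> param \<theta>)"
  shows "smooth_on (coord \<phi> ` (dom \<phi> \<inter> U)) (u \<circ> param \<phi>)"
proof -
  have opU: "open (coord \<theta> ` U)" using open_coord_image[OF \<theta> U(1)] U(2) by (simp add: Int_absorb1)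
  have op: "open (coord \<phi> ` (dom \<phi> \<inter> U))" by (rule open_coord_image[OF \<phi> U(1)])
  have "smooth_on (coord \<phi> ` (dom \<phi> \<inter> U)) (\<lambda>a. (u \<circ> param \<theta>) ((coord \<theta> \<circ> param \<phi>) a))"
  proof (rule smooth_on_compose[OF op opU _ _ u])
    show "smooth_on (coord \<phi> ` (dom \<phi> \<inter> U)) (coord \<theta> \<circ> param \<phi>)"
      using U(2) by (intro smooth_on_subset[OF smooth_transition[OF \<phi> \<theta>]]) auto
    show "(coord \<theta> \<circ> param \<phi>) ` coord \<phi> ` (dom \<phi> \<inter> U) \<subseteq> coord \<theta> ` U"
      using param_coord[OF \<phi>] by auto
  qed
  then show ?thesis
    by (rule smooth_on_cong[OF op]) (use U(2) param_coord[OF \<phi>] param_coord[OF \<theta>] in auto)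
qed

lemma smooth_fun_chart:
  assumes "\<theta> \<in> atlas M" "openin (man_top M) U" "U \<subseteq> dom \<theta>" "smooth_on (coord \<theta> ` U) (u \<circ> param \<theta>)"
  shows "smooth_fun M U u"
  using smooth_chart_change[OF _ assms] by (simp add: smooth_fun_def)

text \<open>In a chart \<psi> the components are a directional derivative of the transition from
  \<phi> to \<psi>, taken at the point carried back to \<phi>; both transition maps enter.\<close>

lemma smooth_field_const_field:
  assumes \<phi>: "\<phi> \<in> atlas M" shows "smooth_field M (dom \<phi>) (const_field M \<phi> v)"
  unfolding smooth_field_def
proof
  fix \<psi> assume \<psi>: "\<psi> \<in> atlas M"
  have op: "open (coord \<psi> ` (dom \<psi> \<inter> dom \<phi>))" "open (coord \<phi> ` (dom \<phi> \<inter> dom \<psi>))"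
    using open_coord_image openin_dom \<phi> \<psi> by blast+
  have "smooth_on (coord \<psi> ` (dom \<psi> \<inter> dom \<phi>))
      (\<lambda>b. frechet_derivative (coord \<psi> \<circ> param \<phi>) (at ((coord \<phi> \<circ> param \<psi>) b)) v)"
    by (rule smooth_on_compose[OF op _ smooth_transition[OF \<psi> \<phi>] smooth_on_frechet[OF smooth_transition[OF \<phi> \<psi>]]])
      (use param_coord[OF \<psi>] in auto)
  then show "smooth_on (coord \<psi> ` (dom \<psi> \<inter> dom \<phi>)) ((\<lambda>q. comps M \<psi> q (const_field M \<phi> v q)) \<circ> param \<psi>)"
    by (rule smooth_on_cong[OF op(1)]) (use comps_const_field[OF \<phi> _ \<psi>] param_coord[OF \<psi>] in \<open>auto simp: jac_def\<close>)
qed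

lemma smooth_field_cong:
  assumes "openin (man_top M) U" "smooth_field M U X" "\<And>q. q \<in> U \<Longrightarrow> X q = Y q"
  shows "smooth_field M U Y"
  unfolding smooth_field_def
proof
  fix \<phi> assume \<phi>: "\<phi> \<in> atlas M"
  have "smooth_on (coord \<phi> ` (dom \<phi> \<inter> U)) ((\<lambda>q. comps M \<phi> q (X q)) \<circ> param \<phi>)"
    using \<phi> assms(2) by (auto simp: smooth_field_def)
  then show "smooth_on (coord \<phi> ` (dom \<phi> \<inter> U)) ((\<lambda>q. comps M \<phi> q (Y q)) \<circ> param \<phi>)"
    by (rule smooth_on_cong[OF open_coord_image[OF \<phi> assms(1)]])
      (use assms(3) param_coord[OF \<phi>] in auto)
qed

lemma smooth_field_subset: "smooth_field M U X \<Longrightarrow> V \<subseteq> U \<Longrightarrow> smooth_field M V X"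
  unfolding smooth_field_def by (meson Int_mono image_mono smooth_on_subset subset_refl)

lemma smooth_field_scale_sum:
  assumes "openin (man_top M) U" "\<And>i. i \<in> I \<Longrightarrow> smooth_fun M U (u i)" "\<And>i. i \<in> I \<Longrightarrow> smooth_field M U (X i)"
  shows "smooth_field M U (\<lambda>q. \<Sum>i\<in>I. u i q *\<^sub>R X i q)"
  unfolding smooth_field_def
proof
  fix \<phi> assume \<phi>: "\<phi> \<in> atlas M"
  let ?S = "coord \<phi> ` (dom \<phi> \<inter> U)"
  have op: "open ?S" by (rule open_coord_image[OF \<phi> assms(1)])
  have "smooth_on ?S (\<lambda>a. \<Sum>i\<in>I. (u i \<circ> param \<phi>) a *\<^sub>R ((\<lambda>q. comps M \<phi> q (X i q)) \<circ> param \<phi>) a)"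
    using assms(2,3) \<phi> unfolding smooth_fun_def smooth_field_def
    by (intro smooth_on_sum_scaleR[OF op]) blast+
  then show "smooth_on ?S ((\<lambda>q. comps M \<phi> q (\<Sum>i\<in>I. u i q *\<^sub>R X i q)) \<circ> param \<phi>)"
  proof (rule smooth_on_cong[OF op])
    fix a assume "a \<in> ?S"
    then have "linear (comps M \<phi> (param \<phi> a))" using linear_comps[OF \<phi>] param_coord[OF \<phi>] by auto
    then show "(\<Sum>i\<in>I. (u i \<circ> param \<phi>) a *\<^sub>R ((\<lambda>q. comps M \<phi> q (X i q)) \<circ> param \<phi>) a) =
        ((\<lambda>q. comps M \<phi> q (\<Sum>i\<in>I. u i q *\<^sub>R X i q)) \<circ> param \<phi>) a"
      by (simp add: linear_sum linear_scale)
  qed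
qed

end

section \<open>Smooth maps, tangent maps and fields along a map\<close>

locale smooth_mfd_map = M: smooth_mfd M + N: smooth_mfd N
  for M :: "('m, 'v::euclidean_space) manifold" and N :: "('a, 'e::euclidean_space) manifold" +
  fixes f :: "'m \<Rightarrow> 'a"
  assumes smooth_map: "smooth_map M N f"
begin

lemma f_points: "p \<in> points M \<Longrightarrow> f p \<in> points N"
  using smooth_map by (auto simp: smooth_map_def continuous_map_def)

lemma open_rep:
  assumes "\<phi> \<in> atlas M" "\<psi> \<in> atlas N" shows "open (coord \<phi> ` (dom \<phi> \<inter> f -` dom \<psi>))"
proof -
  have "openin (man_top M) {q \<in> points M. f q \<in> dom \<psi>}"
    using smooth_map N.openin_dom[OF assms(2)] by (simp add: smooth_map_def continuous_map_def)
  then have "open (coord \<phi> ` (dom \<phi> \<inter> {q \<in> points M. f q \<in> dom \<psi>}))"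
    by (rule M.open_coord_image[OF assms(1)])
  moreover have "dom \<phi> \<inter> {q \<in> points M. f q \<in> dom \<psi>} = dom \<phi> \<inter> f -` dom \<psi>"
    using M.dom_points[OF assms(1)] by auto
  ultimately show ?thesis by simp
qed

lemma smooth_rep:
  "\<phi> \<in> atlas M \<Longrightarrow> \<psi> \<in> atlas N \<Longrightarrow>
    smooth_on (coord \<phi> ` (dom \<phi> \<inter> f -` dom \<psi>)) (coord \<psi> \<circ> f \<circ> param \<phi>)"
  using smooth_map by (auto simp: smooth_map_def)

lemma rep_has_derivative:
  assumes "\<phi> \<in> atlas M" "q \<in> dom \<phi>" "\<psi> \<in> atlas N" "f q \<in> dom \<psi>"
  shows "((coord \<psi> \<circ> f \<circ> param \<phi>) has_derivative
    frechet_derivative (coord \<psi> \<circ> f \<circ> param \<phi>) (at (coord \<phi> q))) (at (coord \<phi> q))"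
  using assms by (intro smooth_on_has_derivative[OF smooth_rep]) auto

text \<open>\<open>tangent_map\<close> is defined through charts that vary with \<open>q\<close>,
  possibly discontinuously. In fixed charts it becomes the derivative of one coordinate expression,
  which can be differentiated further.\<close>

lemma comps_tangent_map:
  assumes \<phi>: "\<phi> \<in> atlas M" "q \<in> dom \<phi>" and \<psi>: "\<psi> \<in> atlas N" "f q \<in> dom \<psi>"
  shows "comps N \<psi> (f q) (tangent_map M N f q v) =
    frechet_derivative (coord \<psi> \<circ> f \<circ> param \<phi>) (at (coord \<phi> q)) (comps M \<phi> q v)"
proof -
  define \<phi>' where "\<phi>' = chart_at M q"
  define \<psi>' where "\<psi>' = chart_at N (f q)"
  have \<phi>': "\<phi>' \<in> atlas M" "q \<in> dom \<phi>'" and \<psi>': "\<psi>' \<in> atlas N" "f q \<in> dom \<psi>'"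
    using M.chart_at_dom[OF \<phi>] N.chart_at_dom[OF \<psi>] by (auto simp: \<phi>'_def \<psi>'_def)
  let ?a = "coord \<phi>' q"
  have eq: "(coord \<psi>' \<circ> f \<circ> param \<phi>') ?a = coord \<psi>' (f q)" using M.param_coord[OF \<phi>'] by simp
  have "((\<lambda>a. (coord \<psi> \<circ> param \<psi>') ((coord \<psi>' \<circ> f \<circ> param \<phi>') a)) has_derivative
      (\<lambda>v. N.jac \<psi>' \<psi> (f q) (frechet_derivative (coord \<psi>' \<circ> f \<circ> param \<phi>') (at ?a) v))) (at ?a)"
    by (rule has_derivative_compose[OF rep_has_derivative[OF \<phi>' \<psi>']])
      (simp only: eq N.jac_has_derivative[OF \<psi>'(1) \<psi>(1) \<psi>'(2) \<psi>(2)])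
  then have "((coord \<psi> \<circ> f \<circ> param \<phi>') has_derivative
      (\<lambda>v. N.jac \<psi>' \<psi> (f q) (frechet_derivative (coord \<psi>' \<circ> f \<circ> param \<phi>') (at ?a) v))) (at ?a)"
  proof (rule has_derivative_transform_within_open[OF _ open_rep[OF \<phi>'(1) \<psi>'(1)]])
    show "?a \<in> coord \<phi>' ` (dom \<phi>' \<inter> f -` dom \<psi>')" using \<phi>' \<psi>' by blast
  qed (use M.param_coord[OF \<phi>'(1)] N.param_coord[OF \<psi>'(1)] in auto)
  then have "N.jac \<psi>' \<psi> (f q) (frechet_derivative (coord \<psi>' \<circ> f \<circ> param \<phi>') (at ?a) v) =
      frechet_derivative (coord \<psi> \<circ> f \<circ> param \<phi>') (at ?a) v"
    by (metis frechet_derivative_at)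
  also have "\<dots> = frechet_derivative (coord \<psi> \<circ> f \<circ> param \<phi>) (at (coord \<phi> q)) (M.jac \<phi>' \<phi> q v)"
    using M.chart_change_frechet[OF \<phi>' \<phi>, of "coord \<psi> \<circ> f"] rep_has_derivative[OF \<phi> \<psi>]
    unfolding differentiable_def by blast
  finally show ?thesis
    by (simp add: N.comps_jac M.comps_jac \<phi>'_def \<psi>'_def tangent_map_def)
qed

lemma linear_tangent_map: "p \<in> points M \<Longrightarrow> linear (tangent_map M N f p)"
  unfolding tangent_map_def
  using has_derivative_linear[OF rep_has_derivative] M.chart_at N.chart_at f_points by blast

lemma smooth_field_along_tangent_map:
  assumes X: "smooth_field M (points M) X"
  shows "smooth_field_along M N f (\<lambda>p. tangent_map M N f p (X p))"
  unfolding smooth_field_along_def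
proof (intro ballI)
  fix \<phi> \<psi> assume \<phi>: "\<phi> \<in> atlas M" and \<psi>: "\<psi> \<in> atlas N"
  let ?S = "coord \<phi> ` (dom \<phi> \<inter> f -` dom \<psi>)"
  let ?F = "coord \<psi> \<circ> f \<circ> param \<phi>"
  have "smooth_on (coord \<phi> ` (dom \<phi> \<inter> points M)) ((\<lambda>q. comps M \<phi> q (X q)) \<circ> param \<phi>)"
    using X \<phi> by (auto simp: smooth_field_def)
  then have "smooth_on ?S ((\<lambda>q. comps M \<phi> q (X q)) \<circ> param \<phi>)"
    by (rule smooth_on_subset) (use M.dom_points[OF \<phi>] in auto)
  then have "smooth_on ?S (\<lambda>a. frechet_derivative ?F (at a) (((\<lambda>q. comps M \<phi> q (X q)) \<circ> param \<phi>) a))"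
  proof (rule smooth_on_linear_family[OF open_rep[OF \<phi> \<psi>]])
    show "smooth_on ?S (\<lambda>a. frechet_derivative ?F (at a) i)" for i
      by (rule smooth_on_frechet[OF smooth_rep[OF \<phi> \<psi>]])
    show "linear (frechet_derivative ?F (at a))" if "a \<in> ?S" for a
      by (rule linear_frechet_derivative[OF smooth_on_differentiable[OF smooth_rep[OF \<phi> \<psi>] that]])
  qed
  then show "smooth_on ?S ((\<lambda>q. comps N \<psi> (f q) (tangent_map M N f q (X q))) \<circ> param \<phi>)"
  proof (rule smooth_on_cong[OF open_rep[OF \<phi> \<psi>]])
    fix a assume "a \<in> ?S"
    then obtain q where q: "q \<in> dom \<phi>" "f q \<in> dom \<psi>" "a = coord \<phi> q" by auto
    then show "frechet_derivative ?F (at a) (((\<lambda>q. comps M \<phi> q (X q)) \<circ> param \<phi>) a) =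
        ((\<lambda>q. comps N \<psi> (f q) (tangent_map M N f q (X q))) \<circ> param \<phi>) a"
      using comps_tangent_map[OF \<phi> q(1) \<psi> q(2)] by (simp only: o_apply M.param_coord[OF \<phi> q(1)])
  qed
qed

text \<open>The hypothesis on \<open>I\<close> concerns fields on open sets of \<open>N\<close>,
  whereas \<open>V\<close> lives along \<open>f\<close>. Applied to coordinate fields it makes the
  coefficients of \<open>I\<close> in a chart smooth, and these can be composed with
  \<open>f\<close>.\<close>

lemma smooth_field_along_endomorphism:
  assumes V: "smooth_field_along M N f V"
    and lin: "\<And>q. q \<in> points N \<Longrightarrow> linear (I q)"
    and I: "\<And>U X. openin (man_top N) U \<Longrightarrow> smooth_field N U X \<Longrightarrow> smooth_field N U (\<lambda>q. I q (X q))"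
  shows "smooth_field_along M N f (\<lambda>p. I (f p) (V p))"
  unfolding smooth_field_along_def
proof (intro ballI)
  fix \<phi> \<psi> assume \<phi>: "\<phi> \<in> atlas M" and \<psi>: "\<psi> \<in> atlas N"
  let ?S = "coord \<phi> ` (dom \<phi> \<inter> f -` dom \<psi>)"
  let ?F = "coord \<psi> \<circ> f \<circ> param \<phi>"
  let ?V = "(\<lambda>q. comps N \<psi> (f q) (V q)) \<circ> param \<phi>"
  define H where "H = (\<lambda>b v. comps N \<psi> (param \<psi> b) (I (param \<psi> b) (const_field N \<psi> v (param \<psi> b))))"
  have pt: "f (param \<phi> a) \<in> dom \<psi>" if "a \<in> ?S" for a using that M.param_coord[OF \<phi>] by auto
  have H: "H (?F a) v = comps N \<psi> (f (param \<phi> a)) (I (f (param \<phi> a)) (const_field N \<psi> v (f (param \<phi> a))))"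
    if "a \<in> ?S" for a v using N.param_coord[OF \<psi> pt[OF that]] by (simp add: H_def)
  have "smooth_on ?S (\<lambda>a. H (?F a) (?V a))"
  proof (rule smooth_on_linear_family[OF open_rep[OF \<phi> \<psi>], of ?V "\<lambda>a. H (?F a)"])
    show "smooth_on ?S ?V" using V \<phi> \<psi> by (auto simp: smooth_field_along_def)
    fix i
    have "smooth_on (coord \<psi> ` (dom \<psi> \<inter> dom \<psi>)) ((\<lambda>q. comps N \<psi> q (I q (const_field N \<psi> i q))) \<circ> param \<psi>)"
      using I[OF N.openin_dom[OF \<psi>] N.smooth_field_const_field[OF \<psi>]] \<psi>
      unfolding smooth_field_def by blast
    then have "smooth_on (coord \<psi> ` dom \<psi>) (\<lambda>b. H b i)" by (simp add: H_def o_def)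
    from smooth_on_compose[OF open_rep[OF \<phi> \<psi>] N.open_coord_dom[OF \<psi>] _ smooth_rep[OF \<phi> \<psi>] this]
    show "smooth_on ?S (\<lambda>a. H (?F a) i)"
      by (rule meta_mp)
        (use M.param_coord[OF \<phi>] in auto)
  next
    fix a assume a: "a \<in> ?S"
    have "H (?F a) = comps N \<psi> (f (param \<phi> a)) \<circ> (I (f (param \<phi> a)) \<circ> (\<lambda>v. const_field N \<psi> v (f (param \<phi> a))))"
      by (rule ext) (simp only: H[OF a, unfolded o_apply] o_apply)
    moreover have "linear (comps N \<psi> (f (param \<phi> a)) \<circ> (I (f (param \<phi> a)) \<circ> (\<lambda>v. const_field N \<psi> v (f (param \<phi> a)))))"
      by (intro linear_compose N.linear_comps N.linear_const_field lin \<psi> pt[OF a] N.dom_points[OF \<psi>])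
    ultimately show "linear (H (?F a))" by simp
  qed
  then show "smooth_on ?S ((\<lambda>q. comps N \<psi> (f q) (I (f q) (V q))) \<circ> param \<phi>)"
  proof (rule smooth_on_cong[OF open_rep[OF \<phi> \<psi>]])
    fix a assume a: "a \<in> ?S"
    show "H (?F a) (?V a) = ((\<lambda>q. comps N \<psi> (f q) (I (f q) (V q))) \<circ> param \<phi>) a"
      by (simp only: H[OF a, unfolded o_apply] o_apply N.const_field_comps[OF \<psi> pt[OF a]])
  qed
qed

end

section \<open>Connections in charts\<close>

locale connection = smooth_mfd N
  for N :: "('p, 'v::euclidean_space) manifold" +
  fixes nab :: "'p \<Rightarrow> 'v \<Rightarrow> ('p \<Rightarrow> 'v) \<Rightarrow> 'v"
  assumes affine_connection: "affine_connection N nab"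
begin

lemma nab_linear: "p \<in> points N \<Longrightarrow> smooth_field_near N p W \<Longrightarrow> linear (\<lambda>v. nab p v W)"
  using affine_connection by (auto simp: affine_connection_def)

lemma nab_add:
  "p \<in> points N \<Longrightarrow> smooth_field_near N p W \<Longrightarrow> smooth_field_near N p Z \<Longrightarrow>
    nab p v (\<lambda>q. W q + Z q) = nab p v W + nab p v Z"
  using affine_connection by (auto simp: affine_connection_def)

lemma nab_leibniz:
  "p \<in> points N \<Longrightarrow> smooth_fun_near N p u \<Longrightarrow> smooth_field_near N p W \<Longrightarrow>
    nab p v (\<lambda>q. u q *\<^sub>R W q) = dir_deriv N u p v *\<^sub>R W p + u p *\<^sub>R nab p v W"
  using affine_connection by (auto simp: affine_connection_def)

lemma dir_deriv_locally_const:
  assumes "openin (man_top N) U" "p \<in> U" "\<And>q. q \<in> U \<Longrightarrow> u q = c"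
  shows "dir_deriv N u p v = 0"
proof -
  let ?\<psi> = "chart_at N p"
  have p: "p \<in> points N" using assms(1,2) openin_subset by blast
  have "frechet_derivative (u \<circ> param ?\<psi>) (at (coord ?\<psi> p)) = frechet_derivative (\<lambda>_. c) (at (coord ?\<psi> p))"
    by (rule frechet_derivative_cong_open[OF open_coord_image[OF chart_at(1)[OF p] assms(1)]])
      (use chart_at[OF p] assms(2,3) param_coord[OF chart_at(1)[OF p]] in auto)
  then show ?thesis by (simp add: dir_deriv_def)
qed

lemma smooth_fun_locally_const:
  assumes "openin (man_top N) U" "\<And>q. q \<in> U \<Longrightarrow> u q = c" shows "smooth_fun N U u"
  unfolding smooth_fun_def
proof
  fix \<phi> assume \<phi>: "\<phi> \<in> atlas N"
  show "smooth_on (coord \<phi> ` (dom \<phi> \<inter> U)) (u \<circ> param \<phi>)"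
    by (rule smooth_on_cong[OF open_coord_image[OF \<phi> assms(1)] smooth_on_const[of _ c]])
      (use assms(2) param_coord[OF \<phi>] in auto)
qed

text \<open>Locality follows from the Leibniz rule for the indicator function of \<open>U\<close>, which is smooth near \<open>p\<close>.\<close>

lemma nab_cong:
  assumes U: "openin (man_top N) U" "p \<in> U" and W: "smooth_field N U W"
    and eq: "\<And>q. q \<in> U \<Longrightarrow> W q = Z q"
  shows "nab p v W = nab p v Z"
proof -
  have p: "p \<in> points N" using U openin_subset by blast
  define u :: "'p \<Rightarrow> real" where "u q = (if q \<in> U then 1 else 0)" for q
  have u: "smooth_fun_near N p u"
    unfolding smooth_fun_near_def using U smooth_fun_locally_const[OF U(1), of u 1] by (auto simp: u_def)
  have d: "dir_deriv N u p v = 0" by (rule dir_deriv_locally_const[OF U, of u 1]) (simp add: u_def)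
  have Z: "smooth_field N U Z" using smooth_field_cong[OF U(1) W] eq by blast
  have "nab p v (\<lambda>q. u q *\<^sub>R X q) = nab p v X" if "smooth_field N U X" for X
    using nab_leibniz[OF p u, of X v] that U d by (auto simp: smooth_field_near_def u_def)
  moreover have "(\<lambda>q. u q *\<^sub>R W q) = (\<lambda>q. u q *\<^sub>R Z q)" using eq by (auto simp: u_def)
  ultimately show ?thesis using W Z by metis
qed

lemma nab_scale_sum:
  assumes U: "openin (man_top N) U" "p \<in> U" and "finite I"
    and u: "\<And>i. i \<in> I \<Longrightarrow> smooth_fun N U (u i)" and X: "\<And>i. i \<in> I \<Longrightarrow> smooth_field N U (X i)"
  shows "nab p v (\<lambda>q. \<Sum>i\<in>I. u i q *\<^sub>R X i q) =
    (\<Sum>i\<in>I. dir_deriv N (u i) p v *\<^sub>R X i p + u i p *\<^sub>R nab p v (X i))"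
  using \<open>finite I\<close> u X
proof induction
  have p: "p \<in> points N" using U openin_subset by blast
  {
    case empty
    have z: "smooth_fun_near N p (\<lambda>_. 0)"
      using U smooth_fun_locally_const[OF U(1), of "\<lambda>_. 0" 0] by (auto simp: smooth_fun_near_def)
    have zf: "smooth_field_near N p (\<lambda>_. 0)"
      using U smooth_field_scale_sum[OF U(1), of "{}"] by (auto simp: smooth_field_near_def)
    \<comment> \<open>The empty sum is read as the zero function times the zero field, so both terms
      of the Leibniz rule vanish.\<close>
    show ?case using nab_leibniz[OF p z zf, of v] by simp
  next
    case (insert i I)
    have near: "smooth_field_near N p (\<lambda>q. \<Sum>i\<in>I. u i q *\<^sub>R X i q)" "smooth_field_near N p (\<lambda>q. u i q *\<^sub>R X i q)"
      "smooth_field_near N p (X i)" "smooth_fun_near N p (u i)"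
      using U insert.prems smooth_field_scale_sum[OF U(1), of I u X] smooth_field_scale_sum[OF U(1), of "{i}" u X]
      by (auto simp: smooth_field_near_def smooth_fun_near_def)
    show ?case
      using insert nab_add[OF p near(2,1), of v] nab_leibniz[OF p near(4,3), of v] by simp
  }
qed

text \<open>Near \<open>p\<close>, \<open>W\<close> is a combination of coordinate fields, and the
  Leibniz rule splits off the derivatives of its coefficients. The remaining terms recombine because
  \<open>nab p v (const_field N \<psi> w)\<close> is linear in \<open>w\<close>.\<close>

lemma nab_chart:
  assumes p: "p \<in> points N" and W: "smooth_field_near N p W"
  defines "\<psi> \<equiv> chart_at N p"
  shows "nab p v W = frechet_derivative ((\<lambda>q. comps N \<psi> q (W q)) \<circ> param \<psi>) (at (coord \<psi> p)) v
    + nab p v (const_field N \<psi> (W p))"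
proof -
  have \<psi>: "\<psi> \<in> atlas N" "p \<in> dom \<psi>" using chart_at[OF p] by (auto simp: \<psi>_def)
  obtain U' where U': "openin (man_top N) U'" "p \<in> U'" "smooth_field N U' W"
    using W by (auto simp: smooth_field_near_def)
  define U where "U = dom \<psi> \<inter> U'"
  have U: "openin (man_top N) U" "p \<in> U" "U \<subseteq> dom \<psi>"
    using openin_dom[OF \<psi>(1)] U' \<psi> by (auto simp: U_def)
  have WU: "smooth_field N U W" using smooth_field_subset[OF U'(3)] by (simp add: U_def)
  have cU: "smooth_field N U (const_field N \<psi> w)" for w
    by (rule smooth_field_subset[OF smooth_field_const_field[OF \<psi>(1)] U(3)])
  have repr: "const_field N \<psi> w q = (\<Sum>k\<in>Basis. (w \<bullet> k) *\<^sub>R const_field N \<psi> k q)" if "q \<in> U" for q w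
    by (rule linear_sum_Basis) (use linear_const_field[OF \<psi>(1)] that U(3) in auto)
  have "nab p v (const_field N \<psi> w) = nab p v (\<lambda>q. \<Sum>k\<in>Basis. (w \<bullet> k) *\<^sub>R const_field N \<psi> k q)" for w
    by (rule nab_cong[OF U(1,2) cU repr])
  also have "\<dots> w = (\<Sum>k\<in>Basis. (w \<bullet> k) *\<^sub>R nab p v (const_field N \<psi> k))" for w
    by (subst nab_scale_sum[OF U(1,2)])
      (auto simp: cU dir_deriv_locally_const[OF U(1,2)] intro: smooth_fun_locally_const[OF U(1)])
  finally have Gamma: "nab p v (const_field N \<psi> w) = (\<Sum>k\<in>Basis. (w \<bullet> k) *\<^sub>R nab p v (const_field N \<psi> k))" for w .
  let ?W = "(\<lambda>q. comps N \<psi> q (W q)) \<circ> param \<psi>"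
  have smW: "smooth_on (coord \<psi> ` U) ?W"
    using WU \<psi>(1) U(3) by (auto simp: smooth_field_def Int_absorb1)
  have opU: "open (coord \<psi> ` U)" using open_coord_image[OF \<psi>(1) U(1)] U(3) by (simp add: Int_absorb1)
  have uU: "smooth_fun N U (\<lambda>q. comps N \<psi> q (W q) \<bullet> k)" for k
    using Ck_on_bounded_linear_comp[OF opU bounded_linear_inner_left, of _ ?W k] smW
    by (intro smooth_fun_chart[OF \<psi>(1) U(1,3)]) (auto simp: smooth_on_def o_def)
  have du: "dir_deriv N (\<lambda>q. comps N \<psi> q (W q) \<bullet> k) p v = frechet_derivative ?W (at (coord \<psi> p)) v \<bullet> k" for k
  proof -
    have "((\<lambda>b. ?W b \<bullet> k) has_derivative (\<lambda>v. frechet_derivative ?W (at (coord \<psi> p)) v \<bullet> k)) (at (coord \<psi> p))"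
      by (rule bounded_linear.has_derivative[OF bounded_linear_inner_left smooth_on_has_derivative[OF smW]])
        (use U(2) in blast)
    from frechet_derivative_at[OF this] show ?thesis
      unfolding dir_deriv_def \<psi>_def[symmetric] by (simp add: o_def fun_eq_iff)
  qed
  have W_eq: "W q = (\<Sum>k\<in>Basis. (comps N \<psi> q (W q) \<bullet> k) *\<^sub>R const_field N \<psi> k q)" if "q \<in> U" for q
    using repr[OF that, of "comps N \<psi> q (W q)"] const_field_comps[OF \<psi>(1), of q] that U(3) by auto
  have "nab p v W = nab p v (\<lambda>q. \<Sum>k\<in>Basis. (comps N \<psi> q (W q) \<bullet> k) *\<^sub>R const_field N \<psi> k q)"
    by (rule nab_cong[OF U(1,2) WU W_eq])
  also have "\<dots> = (\<Sum>k\<in>Basis. (frechet_derivative ?W (at (coord \<psi> p)) v \<bullet> k) *\<^sub>R k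
      + (W p \<bullet> k) *\<^sub>R nab p v (const_field N \<psi> k))"
    by (subst nab_scale_sum[OF U(1,2) finite_Basis])
      (simp_all add: uU cU du const_field_chart_at[OF p, folded \<psi>_def] comps_chart_at[OF p, folded \<psi>_def])
  also have "\<dots> = frechet_derivative ?W (at (coord \<psi> p)) v + nab p v (const_field N \<psi> (W p))"
    by (simp only: sum.distrib euclidean_representation Gamma[symmetric])
  finally show ?thesis .
qed

end

section \<open>The Kaehler structure in the chart at a point\<close>

locale kaehler = smooth_mfd N
  for N :: "('p, 'v::euclidean_space) manifold" +
  fixes g :: "'p \<Rightarrow> 'v \<Rightarrow> 'v \<Rightarrow> real" and J :: "'p \<Rightarrow> 'v \<Rightarrow> 'v" and nab :: "'p \<Rightarrow> 'v \<Rightarrow> ('p \<Rightarrow> 'v) \<Rightarrow> 'v"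
  assumes kaehler: "kaehler_manifold N g J nab"
begin

sublocale connection N nab
  by unfold_locales (use kaehler in \<open>simp add: kaehler_manifold_def levi_civita_def\<close>)

lemma inner_form_g: "p \<in> points N \<Longrightarrow> inner_form (g p)"
  using kaehler by unfold_locales (auto simp: kaehler_manifold_def riemannian_metric_def)

lemma linear_J: "p \<in> points N \<Longrightarrow> linear (J p)"
  and J_J: "p \<in> points N \<Longrightarrow> J p (J p v) = - v"
  and J_isom: "p \<in> points N \<Longrightarrow> g p (J p v) (J p w) = g p v w"
  and smooth_J: "openin (man_top N) U \<Longrightarrow> smooth_field N U X \<Longrightarrow> smooth_field N U (\<lambda>q. J q (X q))"
  and nab_J: "p \<in> points N \<Longrightarrow> smooth_field_near N p W \<Longrightarrow> nab p v (\<lambda>q. J q (W q)) = J p (nab p v W)"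
  using kaehler by (simp_all add: kaehler_manifold_def)

lemma nab_metric:
  "p \<in> points N \<Longrightarrow> smooth_field_near N p Y \<Longrightarrow> smooth_field_near N p Z \<Longrightarrow>
    dir_deriv N (\<lambda>q. g q (Y q) (Z q)) p v = g p (nab p v Y) (Z p) + g p (Y p) (nab p v Z)"
  using kaehler by (simp add: kaehler_manifold_def levi_civita_def)

lemma smooth_g:
  "openin (man_top N) U \<Longrightarrow> smooth_field N U X \<Longrightarrow> smooth_field N U Y \<Longrightarrow> smooth_fun N U (\<lambda>q. g q (X q) (Y q))"
  using kaehler by (simp add: kaehler_manifold_def riemannian_metric_def)

text \<open>The Christoffel symbols as a bilinear map on the model space. They depend on the chart,
  which is therefore fixed to be the one in which tangent vectors at \<open>p\<close> are
  expressed.\<close>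

definition christoffel :: "'p \<Rightarrow> 'v \<Rightarrow> 'v \<Rightarrow> 'v" where
  "christoffel p v w = nab p v (const_field N (chart_at N p) w)"

context
  fixes p assumes p: "p \<in> points N"
begin

lemma smooth_field_near_const_field: "smooth_field_near N p (const_field N (chart_at N p) v)"
  unfolding smooth_field_near_def
  using openin_dom chart_at[OF p] smooth_field_const_field by blast

text \<open>Fields with constant components in a common chart have zero Lie bracket, so this is
  torsion-freeness.\<close>

lemma christoffel_sym: "christoffel p v w = christoffel p w v"
proof -
  let ?\<psi> = "chart_at N p"
  have "frechet_derivative ((\<lambda>q. comps N ?\<psi> q (const_field N ?\<psi> v q)) \<circ> param ?\<psi>) (at (coord ?\<psi> p)) =
      frechet_derivative (\<lambda>_. v) (at (coord ?\<psi> p))" for v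
    by (rule frechet_derivative_cong_open[OF open_coord_dom[OF chart_at(1)[OF p]]])
      (use chart_at[OF p] comps_const_field_same[OF chart_at(1)[OF p]] param_coord[OF chart_at(1)[OF p]] in auto)
  then have "lie_bracket N (const_field N ?\<psi> v) (const_field N ?\<psi> w) p = 0"
    by (simp add: lie_bracket_def Let_def)
  moreover have "nab p (X p) Y - nab p (Y p) X = lie_bracket N X Y p"
    if "smooth_field_near N p X" "smooth_field_near N p Y" for X Y
    using kaehler p that by (simp add: kaehler_manifold_def levi_civita_def)
  ultimately have "nab p v (const_field N ?\<psi> w) - nab p w (const_field N ?\<psi> v) = 0"
    using smooth_field_near_const_field const_field_chart_at[OF p] by metis
  then show ?thesis by (simp add: christoffel_def)
qed

lemma christoffel_linear_left: "linear (\<lambda>v. christoffel p v w)"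
  using nab_linear[OF p smooth_field_near_const_field] by (simp add: christoffel_def)

text \<open>Linearity in the direction is an axiom of the connection; symmetry transfers it to the
  field slot.\<close>

lemma christoffel_linear_right: "linear (christoffel p v)"
  using christoffel_linear_left[of v] by (subst (asm) christoffel_sym) (simp add: eta_contract_eq)

text \<open>Metric compatibility for two coordinate fields, put as a derivative of the coefficients
  of \<open>g\<close> so that it can be composed with \<open>F\<close>.\<close>

lemma metric_chart_has_derivative:
  defines "\<psi> \<equiv> chart_at N p"
  shows "((\<lambda>b. g (param \<psi> b) (const_field N \<psi> v (param \<psi> b)) (const_field N \<psi> w (param \<psi> b))) has_derivative
    (\<lambda>u. g p (christoffel p u v) w + g p v (christoffel p u w))) (at (coord \<psi> p))"
proof -
  have \<psi>: "\<psi> \<in> atlas N" "p \<in> dom \<psi>" using chart_at[OF p] by (auto simp: \<psi>_def)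
  let ?G = "(\<lambda>q. g q (const_field N \<psi> v q) (const_field N \<psi> w q)) \<circ> param \<psi>"
  have "smooth_on (coord \<psi> ` (dom \<psi> \<inter> dom \<psi>)) ?G"
    using smooth_g[OF openin_dom[OF \<psi>(1)] smooth_field_const_field smooth_field_const_field] \<psi>(1)
    unfolding smooth_fun_def by blast
  then have "(?G has_derivative frechet_derivative ?G (at (coord \<psi> p))) (at (coord \<psi> p))"
    by (rule smooth_on_has_derivative) (use \<psi> in blast)
  moreover have "frechet_derivative ?G (at (coord \<psi> p)) = (\<lambda>u. g p (christoffel p u v) w + g p v (christoffel p u w))"
    using nab_metric[OF p smooth_field_near_const_field smooth_field_near_const_field, of v w]
    by (simp add: dir_deriv_def \<psi>_def christoffel_def const_field_chart_at[OF p] fun_eq_iff)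
  ultimately have "(?G has_derivative (\<lambda>u. g p (christoffel p u v) w + g p v (christoffel p u w))) (at (coord \<psi> p))"
    by (simp only:)
  then show ?thesis by (simp only: o_def)
qed

text \<open>\<open>nab_chart\<close> splits the covariant derivative of \<open>J\<close> applied to
  a coordinate field into the wanted derivative of components and a Christoffel term;
  \<open>nab_J\<close> evaluates the total.\<close>

lemma J_chart_has_derivative:
  defines "\<psi> \<equiv> chart_at N p"
  shows "((\<lambda>b. comps N \<psi> (param \<psi> b) (J (param \<psi> b) (const_field N \<psi> v (param \<psi> b)))) has_derivative
    (\<lambda>u. J p (christoffel p u v) - christoffel p u (J p v))) (at (coord \<psi> p))"
proof -
  have \<psi>: "\<psi> \<in> atlas N" "p \<in> dom \<psi>" using chart_at[OF p] by (auto simp: \<psi>_def)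
  let ?W = "\<lambda>q. J q (const_field N \<psi> v q)"
  let ?G = "(\<lambda>q. comps N \<psi> q (?W q)) \<circ> param \<psi>"
  have sm: "smooth_field N (dom \<psi>) ?W"
    by (rule smooth_J[OF openin_dom[OF \<psi>(1)] smooth_field_const_field[OF \<psi>(1)]])
  then have near: "smooth_field_near N p ?W"
    unfolding smooth_field_near_def using openin_dom[OF \<psi>(1)] \<psi>(2) by blast
  have "smooth_on (coord \<psi> ` (dom \<psi> \<inter> dom \<psi>)) ?G"
    using sm \<psi>(1) unfolding smooth_field_def by blast
  then have "(?G has_derivative frechet_derivative ?G (at (coord \<psi> p))) (at (coord \<psi> p))"
    by (rule smooth_on_has_derivative) (use \<psi> in blast)
  moreover have "frechet_derivative ?G (at (coord \<psi> p)) u = J p (christoffel p u v) - christoffel p u (J p v)" for u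
    using nab_chart[OF p near, of u] nab_J[OF p smooth_field_near_const_field, of u v]
    by (simp add: \<psi>_def christoffel_def const_field_chart_at[OF p] algebra_simps)
  then have "frechet_derivative ?G (at (coord \<psi> p)) = (\<lambda>u. J p (christoffel p u v) - christoffel p u (J p v))" by (rule ext)
  ultimately have "(?G has_derivative (\<lambda>u. J p (christoffel p u v) - christoffel p u (J p v))) (at (coord \<psi> p))" by (simp only:)
  then show ?thesis by (simp only: o_def)
qed

end

end

section \<open>The second fundamental form\<close>

text \<open>The product rule for a matrix times a vector when the derivative of the matrix is known
  column by column.\<close>

lemma linear_family_has_derivative:
  fixes l :: "'a::euclidean_space \<Rightarrow> 'b::euclidean_space \<Rightarrow> 'c::euclidean_space"
  assumes S: "open S" "a \<in> S" and lin: "\<And>x. x \<in> S \<Longrightarrow> linear (l x)"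
    and l: "\<And>k. k \<in> Basis \<Longrightarrow> ((\<lambda>x. l x k) has_derivative (\<lambda>u. E u k)) (at a)"
    and E: "\<And>u. linear (E u)" and w: "(w has_derivative Dw) (at a)"
  shows "((\<lambda>x. l x (w x)) has_derivative (\<lambda>u. E u (w a) + l a (Dw u))) (at a)"
proof -
  have "((\<lambda>x. \<Sum>k\<in>Basis. (w x \<bullet> k) *\<^sub>R l x k) has_derivative
      (\<lambda>u. \<Sum>k\<in>Basis. (w a \<bullet> k) *\<^sub>R E u k + (Dw u \<bullet> k) *\<^sub>R l a k)) (at a)"
    by (intro has_derivative_sum has_derivative_scaleR l w
        bounded_linear.has_derivative[OF bounded_linear_inner_left])
  moreover have "(\<Sum>k\<in>Basis. (w a \<bullet> k) *\<^sub>R E u k + (Dw u \<bullet> k) *\<^sub>R l a k) = E u (w a) + l a (Dw u)" for u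
    by (simp add: sum.distrib linear_sum_Basis[OF E, symmetric] linear_sum_Basis[OF lin[OF S(2)], symmetric])
  ultimately have "((\<lambda>x. \<Sum>k\<in>Basis. (w x \<bullet> k) *\<^sub>R l x k) has_derivative (\<lambda>u. E u (w a) + l a (Dw u))) (at a)"
    by simp
  then show ?thesis
    by (rule has_derivative_transform_within_open[OF _ S]) (rule linear_sum_Basis[OF lin, symmetric])
qed

section \<open>Covariant differentiation of fields along the immersion\<close>

locale lagrangian_kaehler_point = smooth_mfd_map M N f + K: kaehler N g J nab
  for M :: "('m, 'v::euclidean_space) manifold" and N :: "('a, 'e::euclidean_space) manifold"
    and f :: "'m \<Rightarrow> 'a" and g J nab +
  fixes p :: 'm
  assumes lagrangian: "lagrangian_submanifold M N g J f" and p: "p \<in> points M"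
begin

abbreviation "\<phi> \<equiv> chart_at M p"
abbreviation "\<psi> \<equiv> chart_at N (f p)"
abbreviation "F \<equiv> coord \<psi> \<circ> f \<circ> param \<phi>"
abbreviation "rep_dom \<equiv> coord \<phi> ` (dom \<phi> \<inter> f -` dom \<psi>)"
abbreviation "base \<equiv> coord \<phi> p"
abbreviation "L \<equiv> tangent_map M N f p"
abbreviation "rep V \<equiv> (\<lambda>q. comps N \<psi> (f q) (V q)) \<circ> param \<phi>"
abbreviation "\<Gamma> \<equiv> K.christoffel (f p)"

lemma fp: "f p \<in> points N" using f_points[OF p] .

lemmas \<phi> = M.chart_at[OF p] and \<psi> = N.chart_at[OF fp]

lemma base: "base \<in> rep_dom" "F base = coord \<psi> (f p)" "param \<phi> base = p"
  using \<phi> \<psi> M.param_coord[OF \<phi>] by auto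

lemma rep_domD:
  assumes "a \<in> rep_dom"
  shows "param \<phi> a \<in> dom \<phi>" "f (param \<phi> a) \<in> dom \<psi>" "coord \<phi> (param \<phi> a) = a" "param \<psi> (F a) = f (param \<phi> a)"
    "f (param \<phi> a) \<in> points N" "param \<phi> a \<in> points M"
  using assms M.param_coord[OF \<phi>(1)] N.param_coord[OF \<psi>(1)] N.dom_points[OF \<psi>(1)] M.dom_points[OF \<phi>(1)] by auto

lemmas open_rep_dom = open_rep[OF \<phi>(1) \<psi>(1)] and smooth_F = smooth_rep[OF \<phi>(1) \<psi>(1)]

lemma rep_base: "rep V base = V p"
  by (simp only: o_apply base(3) N.comps_chart_at[OF fp])

lemma F_has_derivative: "(F has_derivative L) (at base)"
  using rep_has_derivative[OF \<phi> \<psi>] by (simp only: tangent_map_def)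

lemma deriv_along_eq:
  assumes "(rep V has_derivative D) (at base)"
  shows "deriv_along M N nab f p x V = D x + \<Gamma> (L x) (V p)"
  unfolding deriv_along_def Let_def frechet_derivative_at[OF assms, symmetric] K.christoffel_def ..

text \<open>Metric compatibility for fields along \<open>f\<close>. Here \<open>B\<close> holds the
  coefficients of \<open>g\<close> along \<open>f\<close>, and \<open>E\<close> is their derivative,
  whose Christoffel terms complete \<open>DV\<close> and \<open>DW\<close> to covariant
  derivatives.\<close>

lemma metric_along:
  assumes V: "(rep V has_derivative DV) (at base)" and W: "(rep W has_derivative DW) (at base)"
  shows "((\<lambda>a. g (f (param \<phi> a)) (V (param \<phi> a)) (W (param \<phi> a))) has_derivative
    (\<lambda>x. g (f p) (DV x + \<Gamma> (L x) (V p)) (W p) + g (f p) (V p) (DW x + \<Gamma> (L x) (W p)))) (at base)"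
proof -
  interpret G: inner_form "g (f p)" using K.inner_form_g[OF fp] .
  define B where "B a v w = g (f (param \<phi> a)) (const_field N \<psi> v (f (param \<phi> a))) (const_field N \<psi> w (f (param \<phi> a)))"
    for a v w
  define E where "E x v w = g (f p) (\<Gamma> (L x) v) w + g (f p) v (\<Gamma> (L x) w)" for x v w
  have B_lin: "linear (\<lambda>v. B a v w)" "linear (\<lambda>w. B a v w)" if "a \<in> rep_dom" for a v w
  proof -
    interpret g: inner_form "g (f (param \<phi> a))" by (rule K.inner_form_g[OF rep_domD(5)[OF that]])
    note c = N.linear_const_field[OF \<psi>(1) rep_domD(2)[OF that]]
    show "linear (\<lambda>v. B a v w)" "linear (\<lambda>w. B a v w)"
      using linear_compose[OF c g.linear_left] linear_compose[OF c g.linear_right] by (simp_all add: B_def o_def)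
  qed
  have E_lin: "linear (\<lambda>v. E x v w)" "linear (E x v)" for x v w
    unfolding E_def[abs_def]
    using linear_compose[OF K.christoffel_linear_right[OF fp] G.linear_left] linear_compose[OF K.christoffel_linear_right[OF fp] G.linear_right]
    by (auto intro!: linear_compose_add G.linear_left G.linear_right simp: o_def)
  have B_base: "B base v w = g (f p) v w" for v w
    by (simp only: B_def base(3) N.const_field_chart_at[OF fp])
  have B_deriv: "((\<lambda>a. B a v w) has_derivative (\<lambda>x. E x v w)) (at base)" for v w
  proof -
    have "((\<lambda>a. (\<lambda>b. g (param \<psi> b) (const_field N \<psi> v (param \<psi> b)) (const_field N \<psi> w (param \<psi> b))) (F a))
        has_derivative (\<lambda>x. E x v w)) (at base)"
      unfolding E_def
      by (rule has_derivative_compose[OF F_has_derivative]) (simp only: base(2) K.metric_chart_has_derivative[OF fp])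
    then show ?thesis
      by (rule has_derivative_transform_within_open[OF _ open_rep_dom base(1)]) (simp only: B_def rep_domD(4))
  qed
  \<comment> \<open>The product rule is used once per argument: with the second one frozen at
    \<open>k\<close> this gives the columns for its second use, where \<open>k\<close> becomes
    \<open>rep W a\<close>.\<close>
  have "((\<lambda>a. B a (rep V a) k) has_derivative (\<lambda>x. E x (rep V base) k + B base (DV x) k)) (at base)" for k
    by (intro linear_family_has_derivative[OF open_rep_dom base(1), of "\<lambda>a v. B a v k" "\<lambda>x v. E x v k"]
        B_lin B_deriv E_lin V)
  then have "((\<lambda>a. B a (rep V a) (rep W a)) has_derivative
      (\<lambda>x. (E x (rep V base) (rep W base) + B base (DV x) (rep W base)) + B base (rep V base) (DW x))) (at base)"
    by (intro linear_family_has_derivative[OF open_rep_dom base(1), of "\<lambda>a w. B a (rep V a) w"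
          "\<lambda>x k. E x (rep V base) k + B base (DV x) k"] W linear_compose_add E_lin B_lin base)
  then have "((\<lambda>a. B a (rep V a) (rep W a)) has_derivative
      (\<lambda>x. g (f p) (DV x + \<Gamma> (L x) (V p)) (W p) + g (f p) (V p) (DW x + \<Gamma> (L x) (W p)))) (at base)"
    by (simp only: rep_base B_base E_def G.left_simps G.right_simps ac_simps)
  then show ?thesis
    by (rule has_derivative_transform_within_open[OF _ open_rep_dom base(1)])
      (simp only: B_def o_apply N.const_field_comps[OF \<psi>(1) rep_domD(2)])
qed

text \<open>Parallelism of \<open>J\<close> along \<open>f\<close>: the subtracted term is exactly
  what \<open>deriv_along\<close> adds back, leaving \<open>J (f p)\<close> of the covariant
  derivative of \<open>V\<close>.\<close>

lemma J_along:
  assumes V: "(rep V has_derivative DV) (at base)"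
  shows "(rep (\<lambda>q. J (f q) (V q)) has_derivative
    (\<lambda>x. J (f p) (DV x + \<Gamma> (L x) (V p)) - \<Gamma> (L x) (J (f p) (V p)))) (at base)"
proof -
  define H where "H a v = comps N \<psi> (f (param \<phi> a)) (J (f (param \<phi> a)) (const_field N \<psi> v (f (param \<phi> a))))" for a v
  define E where "E x v = J (f p) (\<Gamma> (L x) v) - \<Gamma> (L x) (J (f p) v)" for x v
  have "linear (H a)" if "a \<in> rep_dom" for a
    unfolding H_def[abs_def]
    using linear_compose[OF N.linear_const_field[OF \<psi>(1) rep_domD(2)[OF that]]
        linear_compose[OF K.linear_J[OF rep_domD(5)[OF that]] N.linear_comps[OF \<psi>(1) rep_domD(2)[OF that]]]]
    by (simp add: o_def)
  moreover have "linear (E x)" for x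
    unfolding E_def[abs_def]
    using linear_compose[OF K.christoffel_linear_right[OF fp] K.linear_J[OF fp]]
      linear_compose[OF K.linear_J[OF fp] K.christoffel_linear_right[OF fp]]
    by (intro linear_compose_sub) (simp_all add: o_def)
  moreover have "((\<lambda>a. H a v) has_derivative (\<lambda>x. E x v)) (at base)" for v
  proof -
    have "((\<lambda>a. (\<lambda>b. comps N \<psi> (param \<psi> b) (J (param \<psi> b) (const_field N \<psi> v (param \<psi> b)))) (F a))
        has_derivative (\<lambda>x. E x v)) (at base)"
      unfolding E_def
      by (rule has_derivative_compose[OF F_has_derivative]) (simp only: base(2) K.J_chart_has_derivative[OF fp])
    then show ?thesis
      by (rule has_derivative_transform_within_open[OF _ open_rep_dom base(1)]) (simp only: H_def rep_domD(4))
  qed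
  ultimately have "((\<lambda>a. H a (rep V a)) has_derivative (\<lambda>x. E x (rep V base) + H base (DV x))) (at base)"
    by (intro linear_family_has_derivative[OF open_rep_dom base(1)] V)
  moreover have "H base v = J (f p) v" for v
    by (simp only: H_def base(3) N.const_field_chart_at[OF fp] N.comps_chart_at[OF fp])
  moreover have "E x (V p) + J (f p) (DV x) = J (f p) (DV x + \<Gamma> (L x) (V p)) - \<Gamma> (L x) (J (f p) (V p))" for x
    unfolding E_def linear_add[OF K.linear_J[OF fp]] by (simp only: add_diff_eq add.commute diff_add_eq)
  ultimately have "((\<lambda>a. H a (rep V a)) has_derivative
      (\<lambda>x. J (f p) (DV x + \<Gamma> (L x) (V p)) - \<Gamma> (L x) (J (f p) (V p)))) (at base)"
    by (simp only: rep_base)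
  then show ?thesis
    by (rule has_derivative_transform_within_open[OF _ open_rep_dom base(1)])
      (simp only: H_def o_apply N.const_field_comps[OF \<psi>(1) rep_domD(2)])
qed

sublocale lagrangian_point "g (f p)" "J (f p)" L
proof -
  interpret G: inner_form "g (f p)" using K.inner_form_g[OF fp] .
  show "lagrangian_point (g (f p)) (J (f p)) L"
  proof
    show "inj L" "J (f p) ` range L = {\<xi>. \<forall>w\<in>range L. g (f p) \<xi> w = 0}"
      using lagrangian p unfolding lagrangian_submanifold_def tangent_space_def normal_space_def by blast+
  qed (simp_all only: linear_add[OF K.linear_J[OF fp]] linear_scale[OF K.linear_J[OF fp]]
      linear_add[OF linear_tangent_map[OF p]] linear_scale[OF linear_tangent_map[OF p]] K.J_J[OF fp] K.J_isom[OF fp])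
qed

section \<open>The coordinate Gauss formula and the symmetries of the cubic form\<close>

definition hess :: "'v \<Rightarrow> 'v \<Rightarrow> 'e" where
  "hess x y = frechet_derivative (\<lambda>a. frechet_derivative F (at a) y) (at base) x"

lemma hess_sym: "hess x y = hess y x"
  unfolding hess_def by (rule second_derivative_symmetric[OF open_rep_dom base(1) smooth_F])

lemma hess_has_derivative: "((\<lambda>a. frechet_derivative F (at a) y) has_derivative (\<lambda>x. hess x y)) (at base)"
  unfolding hess_def
  using smooth_on_has_derivative[OF smooth_on_frechet[OF smooth_F] base(1)] by (simp add: eta_contract_eq)

lemma hess_linear: "linear (hess x)"
  using has_derivative_linear[OF hess_has_derivative[of x]] by (subst (asm) hess_sym) (simp add: eta_contract_eq)

text \<open>The coordinate expression of \<open>\<nabla>\<^sub>x (df Y)\<close> when \<open>Y\<close> has constant components \<open>y\<close> in \<open>\<phi>\<close>; the second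
  fundamental form is its normal component.\<close>

definition gauss :: "'v \<Rightarrow> 'v \<Rightarrow> 'e" where "gauss x y = hess x y + \<Gamma> (L x) (L y)"

lemma gauss_sym: "gauss x y = gauss y x"
  by (simp add: gauss_def hess_sym[of x] K.christoffel_sym[OF fp, of "L x"])

text \<open>The extension \<open>Y\<close> enters beyond its value at \<open>p\<close> only through
  the tangent vector \<open>L (D x)\<close>, which the normal projection removes.\<close>

lemma tangent_field_along:
  assumes "smooth_field_near M p Y"
  shows "\<exists>D. (rep (\<lambda>q. tangent_map M N f q (Y q)) has_derivative (\<lambda>x. hess x (Y p) + L (D x))) (at base)"
proof -
  obtain U where U: "openin (man_top M) U" "p \<in> U" "smooth_field M U Y"
    using assms by (auto simp: smooth_field_near_def)
  let ?Y = "(\<lambda>q. comps M \<phi> q (Y q)) \<circ> param \<phi>"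
  have "smooth_on (coord \<phi> ` (dom \<phi> \<inter> U)) ?Y" using U(3) \<phi>(1) by (simp only: smooth_field_def)
  then have "(?Y has_derivative frechet_derivative ?Y (at base)) (at base)"
    by (rule smooth_on_has_derivative) (use \<phi> U in blast)
  then have "((\<lambda>a. frechet_derivative F (at a) (?Y a)) has_derivative
      (\<lambda>x. hess x (?Y base) + frechet_derivative F (at base) (frechet_derivative ?Y (at base) x))) (at base)"
    by (intro linear_family_has_derivative[OF open_rep_dom base(1)] hess_has_derivative hess_linear
        linear_frechet_derivative smooth_on_differentiable[OF smooth_F])
  moreover have "?Y base = Y p" by (simp only: o_apply base(3) M.comps_chart_at[OF p])
  ultimately have "((\<lambda>a. frechet_derivative F (at a) (?Y a)) has_derivative
      (\<lambda>x. hess x (Y p) + L (frechet_derivative ?Y (at base) x))) (at base)"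
    by (simp only: tangent_map_def)
  then have "(rep (\<lambda>q. tangent_map M N f q (Y q)) has_derivative
      (\<lambda>x. hess x (Y p) + L (frechet_derivative ?Y (at base) x))) (at base)"
  proof (rule has_derivative_transform_within_open[OF _ open_rep_dom base(1)])
    fix a assume a: "a \<in> rep_dom"
    show "frechet_derivative F (at a) (?Y a) = rep (\<lambda>q. tangent_map M N f q (Y q)) a"
      using comps_tangent_map[OF \<phi>(1) rep_domD(1)[OF a] \<psi>(1) rep_domD(2)[OF a]]
      by (simp only: rep_domD(3)[OF a] o_apply)
  qed
  then show ?thesis by blast
qed

lemma const_field_near: "smooth_field_near M p (const_field M \<phi> y)"
  unfolding smooth_field_near_def using M.openin_dom[OF \<phi>(1)] \<phi> M.smooth_field_const_field by blast

lemma coord_field_along: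
  "(rep (\<lambda>q. tangent_map M N f q (const_field M \<phi> y q)) has_derivative (\<lambda>x. hess x y)) (at base)"
  by (rule has_derivative_transform_within_open[OF hess_has_derivative open_rep_dom base(1)])
    (simp only: comps_tangent_map[OF \<phi>(1) rep_domD(1) \<psi>(1) rep_domD(2)] rep_domD(3) o_apply
      M.comps_const_field_same[OF \<phi>(1) rep_domD(1)])

lemma normal_component: 
  "normal_component M N g f p w \<in> normal_space M N g f p \<and> w - normal_component M N g f p w \<in> range L"
  using theI'[OF normal_component_ex1[of w]]
  unfolding normal_component_def normal_space_def tangent_space_def .

lemma normal_component_eqI:
  assumes "w - w' \<in> range L" shows "normal_component M N g f p w = normal_component M N g f p w'"
proof -
  let ?n = "normal_component M N g f p w'"
  obtain u v where "w - w' = L u" "w' - ?n = L v" using assms normal_component[of w'] by auto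
  then have "w - ?n = L (u + v)" by (simp add: linear_add[OF linear_L] algebra_simps)
  then have "?n \<in> normal_space M N g f p \<and> w - ?n \<in> range L" using normal_component[of w'] by auto
  then show ?thesis
    using normal_component[of w] normal_component_ex1[of w]
    unfolding normal_space_def tangent_space_def by blast
qed

text \<open>All extensions of \<open>y\<close> give values that differ by tangent vectors, so the
  definite description is met by the common normal component.\<close>

lemma second_ff_eq: "second_ff M N g nab f p x y = normal_component M N g f p (gauss x y)"
  unfolding second_ff_def
proof (rule the_equality)
  let ?V = "\<lambda>Y q. tangent_map M N f q (Y q)"
  have *: "normal_component M N g f p (deriv_along M N nab f p x (?V Y)) = normal_component M N g f p (gauss x y)"
    if Y: "smooth_field_near M p Y" "Y p = y" for Y
  proof -
    obtain D where D: "(rep (?V Y) has_derivative (\<lambda>x. hess x (Y p) + L (D x))) (at base)"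
      using tangent_field_along[OF Y(1)] by blast
    show ?thesis by (rule normal_component_eqI) (simp add: deriv_along_eq[OF D] gauss_def Y(2))
  qed
  then show "\<forall>Y. smooth_field_near M p Y \<and> Y p = y \<longrightarrow>
      normal_component M N g f p (deriv_along M N nab f p x (?V Y)) = normal_component M N g f p (gauss x y)"
    by blast
  fix \<eta>
  assume "\<forall>Y. smooth_field_near M p Y \<and> Y p = y \<longrightarrow>
    normal_component M N g f p (deriv_along M N nab f p x (?V Y)) = \<eta>"
  \<comment> \<open>An extension exists, so the condition on \<eta> is not vacuous and determines
    it.\<close>
  moreover have "smooth_field_near M p (const_field M \<phi> y) \<and> const_field M \<phi> y p = y"
    using const_field_near M.const_field_chart_at[OF p] by (rule conjI)
  ultimately show "\<eta> = normal_component M N g f p (gauss x y)"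
    using * by metis
qed

text \<open>The two first arguments differ by a tangent vector, and \<open>J (f p) (L z)\<close> is
  normal.\<close>

lemma g_second_ff: "g (f p) (second_ff M N g nab f p x y) (J (f p) (L z)) = g (f p) (gauss x y) (J (f p) (L z))"
proof -
  let ?h = "second_ff M N g nab f p x y"
  have "gauss x y - ?h \<in> range L"
    using normal_component[of "gauss x y"] unfolding second_ff_eq by (rule conjunct2)
  then obtain u where u: "gauss x y - ?h = L u" by blast
  have "g (f p) (gauss x y - ?h) (J (f p) (L z)) = g (f p) (J (f p) (L z)) (L u)"
    unfolding u by (rule sym)
  also have "\<dots> = 0" by (rule G_I_L)
  finally show ?thesis unfolding left_simps by (simp only: right_minus_eq)
qed

lemma gauss_J_sym: "g (f p) (gauss x y) (J (f p) (L z)) = g (f p) (gauss x z) (J (f p) (L y))"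
proof -
  define V where "V y q = tangent_map M N f q (const_field M \<phi> y q)" for y q
  define W where "W = (\<lambda>q. J (f q) (V z q))"
  have Vp: "V y p = L y" for y by (simp only: V_def M.const_field_chart_at[OF p])
  have V: "(rep (V y) has_derivative (\<lambda>x. hess x y)) (at base)" for y
    using coord_field_along unfolding V_def .
  \<comment> \<open>Adding the Christoffel term back makes the covariant derivative of
    \<open>W\<close> equal to \<open>J (f p) (gauss x z)\<close>.\<close>
  have W: "(rep W has_derivative (\<lambda>x. J (f p) (gauss x z) - \<Gamma> (L x) (W p))) (at base)"
    using J_along[OF V, of z] by (simp only: W_def Vp gauss_def)
  have "((\<lambda>a. g (f (param \<phi> a)) (V y (param \<phi> a)) (W (param \<phi> a))) has_derivative
      (\<lambda>x. g (f p) (gauss x y) (J (f p) (L z)) + g (f p) (L y) (J (f p) (gauss x z)))) (at base)"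
    using metric_along[OF V W, of y] by (simp only: Vp W_def gauss_def diff_add_cancel)
  \<comment> \<open>The Lagrangian condition is used here on a whole neighbourhood of
    \<open>p\<close>: \<open>V y\<close> is tangent and \<open>W\<close> normal at every nearby
    point, so the product vanishes identically and can be differentiated.\<close>
  moreover have "((\<lambda>a. g (f (param \<phi> a)) (V y (param \<phi> a)) (W (param \<phi> a))) has_derivative (\<lambda>x. 0)) (at base)"
  proof (rule has_derivative_transform_within_open[OF has_derivative_const[of 0] open_rep_dom base(1)])
    fix a assume a: "a \<in> rep_dom"
    let ?q = "param \<phi> a"
    interpret q: inner_form "g (f ?q)" using K.inner_form_g[OF rep_domD(5)[OF a]] .
    have "J (f ?q) ` tangent_space M N f ?q = normal_space M N g f ?q"
      using lagrangian rep_domD(6)[OF a] by (simp add: lagrangian_submanifold_def)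
    moreover have V: "V y ?q \<in> tangent_space M N f ?q" for y
      unfolding V_def tangent_space_def by (rule rangeI)
    ultimately have "W ?q \<in> normal_space M N g f ?q" using W_def by blast
    then have "g (f ?q) (W ?q) (V y ?q) = 0" using V unfolding normal_space_def by blast
    then show "0 = g (f ?q) (V y ?q) (W ?q)" using q.sym[of "V y ?q" "W ?q"] by linarith
  qed
  ultimately have "(\<lambda>x. g (f p) (gauss x y) (J (f p) (L z)) + g (f p) (L y) (J (f p) (gauss x z))) = (\<lambda>x. 0)"
    by (rule has_derivative_unique)
  then have "g (f p) (gauss x y) (J (f p) (L z)) + g (f p) (L y) (J (f p) (gauss x z)) = 0" by (rule fun_cong)
  moreover have "g (f p) (J (f p) (L y)) (gauss x z) = - g (f p) (L y) (J (f p) (gauss x z))" by (rule G_skew)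
  moreover have "g (f p) (J (f p) (L y)) (gauss x z) = g (f p) (gauss x z) (J (f p) (L y))" by (rule sym)
  ultimately show ?thesis by linarith
qed

end

text \<open>Both operators sum over the same chosen normal basis, so the pointwise identity applies
  directly to that choice.\<close>

lemma trencevski_J_eq_J_casorati:
  fixes M :: "('m, real^'n) manifold"
  assumes "lagrangian_kaehler_point M N f g J nab p"
  shows "trencevski_operator M N g nab f p (J (f p) (tangent_map M N f p x)) =
    J (f p) (tangent_map M N f p (casorati_operator M N g nab f p x))"
proof -
  interpret lagrangian_kaehler_point M N f g J nab p by fact
  have normal_space: "normal_space M N g f p = J (f p) ` range L"
    unfolding normal normal_space_def tangent_space_def ..
  define B where "B = (SOME B. normal_onb M N g f p B)"
  have "\<exists>B. normal_onb M N g f p B"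
    using normal_orthonormal_basis_exists unfolding normal_onb_def normal_space .
  then have "normal_onb M N g f p B" unfolding B_def by (rule someI_ex)
  then have B: "finite B" "span B = J (f p) ` range L"
    "\<And>\<xi> \<eta>. \<xi> \<in> B \<Longrightarrow> \<eta> \<in> B \<Longrightarrow> g (f p) \<xi> \<eta> = (if \<xi> = \<eta> then 1 else 0)"
    unfolding normal_onb_def normal_space by blast+
  show ?thesis
    unfolding trencevski_operator_def casorati_operator_def B_def[symmetric]
  proof (rule sum_trace_eq_sum_squares[OF lagrangian_point_axioms _ _ _ B])
    show "g (f p) (second_ff M N g nab f p x y) (J (f p) (L z)) = g (f p) (second_ff M N g nab f p y x) (J (f p) (L z))"
      for x y z by (simp only: second_ff_eq gauss_sym[of x])
    show "g (f p) (second_ff M N g nab f p x y) (J (f p) (L z)) = g (f p) (second_ff M N g nab f p x z) (J (f p) (L y))"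
      for x y z unfolding g_second_ff by (rule gauss_J_sym)
    show "shape_operator M N g nab f p \<xi> x =
        (THE z. \<forall>y. g (f p) (L z) (L y) = g (f p) (second_ff M N g nab f p x y) \<xi>)" for \<xi> x
      by (simp only: shape_operator_def induced_metric_def)
  qed
qed

theorem theorem1:
  fixes n :: nat
    and M :: "('m, real^'n) manifold"
    and N :: "('a, 'e::euclidean_space) manifold"
    and g :: "'a \<Rightarrow> 'e \<Rightarrow> 'e \<Rightarrow> real"
    and J :: "'a \<Rightarrow> 'e \<Rightarrow> 'e"
    and nab :: "'a \<Rightarrow> 'e \<Rightarrow> ('a \<Rightarrow> 'e) \<Rightarrow> 'e"
    and f :: "'m \<Rightarrow> 'a"
    and T :: "'m \<Rightarrow> real^'n"
    and c :: "'m \<Rightarrow> real"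
  assumes "n \<ge> 2" and "CARD('n) = n" and "DIM('e) = 2 * n"
    and "kaehler_manifold N g J nab"
    and "lagrangian_submanifold M N g J f"
    and "unit_tangent_field M N g f T"
    and "\<forall>p\<in>points M. c p > 0"
  shows "(tangential_principal_casorati M N g nab f T c \<longleftrightarrow>
           normal_principal_casorati M N g nab f (\<lambda>p. J (f p) (tangent_map M N f p (T p))) c) \<and>
         ((\<forall>p\<in>points M. casorati_operator M N g nab f p (T p) = c p *\<^sub>R T p) \<longleftrightarrow>
           (\<forall>p\<in>points M.
              trencevski_operator M N g nab f p (J (f p) (tangent_map M N f p (T p)))
                = c p *\<^sub>R J (f p) (tangent_map M N f p (T p))))"
proof -
  let ?JT = "\<lambda>p. J (f p) (tangent_map M N f p (T p))"
  have N: "smooth_manifold N" using assms(4) by (simp add: kaehler_manifold_def)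
  have M: "smooth_manifold M" "smooth_map M N f" using assms(5) by (simp_all add: lagrangian_submanifold_def)
  interpret K: kaehler N g J nab by unfold_locales (fact N assms(4))+
  interpret S: smooth_mfd_map M N f by unfold_locales (fact M)+
  have point: "lagrangian_kaehler_point M N f g J nab p" if "p \<in> points M" for p
    by unfold_locales (fact assms(5) that)+
  \<comment> \<open>\<open>J (f p)\<close> after the tangent map is linear and injective, so it can
    be both applied to the eigenvalue equation and cancelled from it.\<close>
  have eigen: "casorati_operator M N g nab f p (T p) = c p *\<^sub>R T p \<longleftrightarrow>
      trencevski_operator M N g nab f p (?JT p) = c p *\<^sub>R ?JT p" if p: "p \<in> points M" for p
  proof -
    interpret P: lagrangian_kaehler_point M N f g J nab p by (rule point[OF p])
    show ?thesis
      unfolding trencevski_J_eq_J_casorati[OF point[OF p]]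
        linear_scale[OF P.linear_IL, symmetric] P.inj_IL ..
  qed
  \<comment> \<open>This holds for every unit tangent field, so only the eigenvalue equations remain
    to be compared.\<close>
  have "unit_normal_field M N g f ?JT"
    unfolding unit_normal_field_def
  proof (intro conjI ballI)
    have "smooth_field M (points M) T" using assms(6) by (simp add: unit_tangent_field_def)
    from S.smooth_field_along_endomorphism[OF S.smooth_field_along_tangent_map[OF this] K.linear_J K.smooth_J]
    show "smooth_field_along M N f ?JT" .
  next
    fix p assume p: "p \<in> points M"
    interpret P: lagrangian_kaehler_point M N f g J nab p by (rule point[OF p])
    show "?JT p \<in> normal_space M N g f p"
      unfolding normal_space_def tangent_space_def using P.G_I_L by blast
    show "g (f p) (?JT p) (?JT p) = 1"
      using assms(6) p unfolding P.I_isom unit_tangent_field_def induced_metric_def by blast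
  qed
  then show ?thesis
    using assms(6,7) eigen
    unfolding tangential_principal_casorati_def normal_principal_casorati_def by blast
qed

end
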